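(* Let $F$ be an arbitrary quasinorm on $D(e)=\mathrm{span}(X,Y)\cong\mathbb{R}^2$. For any extremal (with $M=1$) on the Cartan group starting at the unit and with $\varphi_3=\varphi_4=\varphi_5=0$, one has $\theta(t)\equiv\theta_0$, $t\in\mathbb{R}$, for some $\theta_0$. In addition, for a given $\theta_0$, every such extremal with $\theta(t)\equiv\theta_0$ is a one-parameter subgroup if and only if the usual derivative $r'(\theta_0)$ exists. In the general case, any extremal with $\varphi_3=\varphi_4=\varphi_5=0$ is a metric straight line.
   Context: The Cartan algebra is the 5-dimensional real Lie algebra with basis $X,Y,Z,V,W$ and $[X,Y]=Z$, $[X,Z]=V$, $[Y,Z]=W$, all other brackets of basis elements zero. The Cartan group $G$ is the connected simply connected Lie group with this Lie algebra, identified with $\mathbb{R}^5$ via $(x,y,z,v,w)\leftrightarrow\exp(xX+yY+zZ+vV+wW)$ (the unit is $0$). A quasinorm $F:\mathbb{R}^2\to[0,\infty)$ satisfies $F(u)=0$ iff $u=0$, $F(\lambda u)=\lambda F(u)$ for $\lambda\ge0$, $F(u+u')\le F(u)+F(u')$ (symmetry is not required); $u_1X+u_2Y$ is identified with $(u_1,u_2)$, and $U=\{u: F(u)\le1\}$. Trajectories are the absolutely continuous solutions of $\dot g=u_1X(g)+u_2Y(g)$ with measurable controls $u(t)=(u_1(t),u_2(t))\in U$; in coordinates $$\dot x=u_1,\quad \dot y=u_2,\quad \dot z=\tfrac12(xu_2-yu_1),$$ $$\dot v=-\tfrac12\left(z+\tfrac16xy\right)u_1+\tfrac1{12}x^2u_2,\quad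 \dot w=-\tfrac1{12}y^2u_1-\tfrac12\left(z-\tfrac16xy\right)u_2 .$$ The left-invariant sub-Finsler quasimetric $d(p,q)$ is the least time needed to go from $p$ to $q$ along such trajectories. A curve $g(t)$, $t\in\mathbb{R}$, is a metric straight line if $d(g(t_1),g(t_2))=t_2-t_1$ for all $t_1\le t_2$. For a covector $\psi=(\psi_1,\dots,\psi_5)$ at $(x,y,z,v,w)$ (components relative to $\partial_x,\partial_y,\partial_z,\partial_v,\partial_w$) put $$h_1=\psi(X)=\psi_1-\tfrac12\psi_3y-\tfrac1{12}\psi_4xy-\tfrac1{12}\psi_5y^2-\tfrac12\psi_4z,$$ $$h_2=\psi(Y)=\psi_2+\tfrac12\psi_3x+\tfrac1{12}\psi_4x^2+\tfrac1{12}\psi_5xy-\tfrac12\psi_5z,$$ and $\mathcal H=h_1u_1+h_2u_2$. An extremal with $M=1$ is a trajectory $g(t)=(x,y,z,v,w)(t)$, $t\in\mathbb{R}$, with control $u(t)$, for which there is an absolutely continuous nowhere vanishing $\psi(t)$ with $\dot\psi=-\partial\mathcal H/\partial(x,y,z,v,w)$ a.e. and, for a.e. $t$, $h_1(t)u_1(t)+h_2(t)u_2(t)=\max_{u\in U}(h_1(t)u_1+h_2(t)u_2)=1$. Put $\varphi_i=\psi_i(0)$, $i=1,\dots,5$. $F_U(h)=\max_{u\in U}h\cdot u$ is the support function of $U$; $(h_1(t),h_2(t))$ lies on the curve $F_U=1$, whose polar equation is $r=r(\theta)$, $\theta\in\mathbb{R}$, and $\theta(t)$ is the continuous function with $h_1(t)=r(\theta(t))\cos\theta(t)$,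 $h_2(t)=r(\theta(t))\sin\theta(t)$. *)

theory Defs
  imports "HOL-Analysis.Analysis"
begin

subsection \<open>Coordinates on a five-dimensional space\<close>

lemma vector_5 [simp]:
  fixes x y z v w :: "'a::zero"
  shows "(vector [x, y, z, v, w] :: 'a^5) $ 1 = x"
    and "(vector [x, y, z, v, w] :: 'a^5) $ 2 = y"
    and "(vector [x, y, z, v, w] :: 'a^5) $ 3 = z"
    and "(vector [x, y, z, v, w] :: 'a^5) $ 4 = v"
    and "(vector [x, y, z, v, w] :: 'a^5) $ 5 = w"
  by (simp_all add: vector_def)

lemma exhaust_5:
  fixes i :: 5
  shows "i = 1 \<or> i = 2 \<or> i = 3 \<or> i = 4 \<or> i = 5"
proof (induct i)
  case (of_int z)
  then have "z = 0 \<or> z = 1 \<or> z = 2 \<or> z = 3 \<or> z = 4"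
    by auto
  then show ?case
    by auto
qed

lemma forall_5: "(\<forall>i::5. P i) \<longleftrightarrow> P 1 \<and> P 2 \<and> P 3 \<and> P 4 \<and> P 5"
  by (metis exhaust_5)

lemma UNIV_5: "(UNIV :: 5 set) = {1, 2, 3, 4, 5}"
  using exhaust_5 by auto

lemma sum_5: "sum f (UNIV :: 5 set) = f 1 + f 2 + f 3 + f 4 + f 5"
  unfolding UNIV_5 by (simp add: ac_simps)

subsection \<open>The Cartan group\<close>

text \<open>
  The components \<open>1, \<dots>, 5\<close> are the coordinates with respect to the basis \<open>X, Y, Z, V, W\<close>
  of the Lie algebra, respectively the exponential coordinates \<open>x, y, z, v, w\<close> on the group.
\<close>

definition cartan_bracket :: "real^5 \<Rightarrow> real^5 \<Rightarrow> real^5" where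
  "cartan_bracket a b =
     vector [0, 0, a$1 * b$2 - a$2 * b$1, a$1 * b$3 - a$3 * b$1, a$2 * b$3 - a$3 * b$2]"

lemma cartan_bracket_Jacobi:
  "cartan_bracket a (cartan_bracket b c) + cartan_bracket b (cartan_bracket c a)
     + cartan_bracket c (cartan_bracket a b) = 0"
  by (simp add: vec_eq_iff forall_5 cartan_bracket_def algebra_simps)

text \<open>
  In exponential coordinates the group law is the Baker--Campbell--Hausdorff series, which
  stops after the third-order terms because the algebra is nilpotent of step 3.
\<close>

definition cartan_mult :: "real^5 \<Rightarrow> real^5 \<Rightarrow> real^5" where
  "cartan_mult a b = a + b + (1/2) *\<^sub>R cartan_bracket a b
     + (1/12) *\<^sub>R (cartan_bracket a (cartan_bracket a b) + cartan_bracket b (cartan_bracket b a))"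

lemma cartan_mult_assoc: "cartan_mult (cartan_mult a b) c = cartan_mult a (cartan_mult b c)"
  by (simp add: vec_eq_iff forall_5 cartan_mult_def cartan_bracket_def field_simps)

lemma cartan_mult_0 [simp]: "cartan_mult 0 a = a" "cartan_mult a 0 = a"
  by (simp_all add: vec_eq_iff forall_5 cartan_mult_def cartan_bracket_def)

lemma cartan_mult_minus [simp]: "cartan_mult a (- a) = 0" "cartan_mult (- a) a = 0"
  by (simp_all add: vec_eq_iff forall_5 cartan_mult_def cartan_bracket_def)

definition one_parameter_subgroup :: "(real \<Rightarrow> real^5) \<Rightarrow> bool" where
  "one_parameter_subgroup g \<longleftrightarrow>
     continuous_on UNIV g \<and> (\<forall>s t. g (s + t) = cartan_mult (g s) (g t))"

definition field_X :: "real^5 \<Rightarrow> real^5" where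
  "field_X p = vector [1, 0, - (1/2) * p$2, - (1/2) * (p$3 + (1/6) * p$1 * p$2), - (1/12) * (p$2)\<^sup>2]"

definition field_Y :: "real^5 \<Rightarrow> real^5" where
  "field_Y p = vector [0, 1, (1/2) * p$1, (1/12) * (p$1)\<^sup>2, - (1/2) * (p$3 - (1/6) * p$1 * p$2)]"

lemma field_X_left_invariant:
  "((\<lambda>s. cartan_mult p (s *\<^sub>R axis 1 1)) has_vector_derivative field_X p) (at 0)"
proof -
  define q where "q = (1/12) *\<^sub>R cartan_bracket (axis 1 1) (cartan_bracket (axis 1 1) p)"
  have eq: "(\<lambda>s. cartan_mult p (s *\<^sub>R axis 1 1)) = (\<lambda>s. p + s *\<^sub>R field_X p + s\<^sup>2 *\<^sub>R q)"
    by (simp add: fun_eq_iff vec_eq_iff forall_5 cartan_mult_def cartan_bracket_def field_X_def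
        q_def axis_def field_simps power2_eq_square)
  show ?thesis
    unfolding eq by (auto intro!: derivative_eq_intros)
qed

lemma field_Y_left_invariant:
  "((\<lambda>s. cartan_mult p (s *\<^sub>R axis 2 1)) has_vector_derivative field_Y p) (at 0)"
proof -
  define q where "q = (1/12) *\<^sub>R cartan_bracket (axis 2 1) (cartan_bracket (axis 2 1) p)"
  have eq: "(\<lambda>s. cartan_mult p (s *\<^sub>R axis 2 1)) = (\<lambda>s. p + s *\<^sub>R field_Y p + s\<^sup>2 *\<^sub>R q)"
    by (simp add: fun_eq_iff vec_eq_iff forall_5 cartan_mult_def cartan_bracket_def field_Y_def
        q_def axis_def field_simps power2_eq_square)
  show ?thesis
    unfolding eq by (auto intro!: derivative_eq_intros)
qed

subsection \<open>Quasinorms and support functions\<close>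

definition quasinorm :: "(real^2 \<Rightarrow> real) \<Rightarrow> bool" where
  "quasinorm F \<longleftrightarrow>
     (\<forall>u. 0 \<le> F u) \<and> (\<forall>u. F u = 0 \<longleftrightarrow> u = 0) \<and>
     (\<forall>c u. 0 \<le> c \<longrightarrow> F (c *\<^sub>R u) = c * F u) \<and>
     (\<forall>u u'. F (u + u') \<le> F u + F u')"

definition control_set :: "(real^2 \<Rightarrow> real) \<Rightarrow> (real^2) set" where
  "control_set F = {u. F u \<le> 1}"

text \<open>For a quasinorm the control set is compact, so the supremum is a maximum.\<close>

definition support_fun :: "(real^2) set \<Rightarrow> real^2 \<Rightarrow> real" where
  "support_fun U h = (SUP u\<in>U. h \<bullet> u)"

text \<open>
  The polar equation \<open>r = r(\<theta>)\<close> of the curve on which the support function of \<open>U\<close> equals 1: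
  every ray from the origin meets this curve exactly once.
\<close>

definition polar_radius :: "(real^2) set \<Rightarrow> real \<Rightarrow> real" where
  "polar_radius U \<theta> = (THE \<rho>. 0 < \<rho> \<and> support_fun U (vector [\<rho> * cos \<theta>, \<rho> * sin \<theta>]) = 1)"

subsection \<open>Trajectories and the sub-Finsler quasimetric\<close>

definition absolutely_continuous_fun_on :: "real set \<Rightarrow> (real \<Rightarrow> 'a::real_normed_vector) \<Rightarrow> bool" where
  "absolutely_continuous_fun_on J f \<longleftrightarrow>
     (\<forall>\<epsilon>>0. \<exists>\<delta>>0. \<forall>D S. D division_of S \<and> S \<subseteq> J \<and> (\<Sum>k\<in>D. Sup k - Inf k) < \<delta> \<longrightarrow>
        (\<Sum>k\<in>D. norm (f (Sup k) - f (Inf k))) < \<epsilon>)"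

definition locally_absolutely_continuous_on :: "real set \<Rightarrow> (real \<Rightarrow> 'a::real_normed_vector) \<Rightarrow> bool" where
  "locally_absolutely_continuous_on J f \<longleftrightarrow>
     (\<forall>a b. {a..b} \<subseteq> J \<longrightarrow> absolutely_continuous_fun_on {a..b} f)"

text \<open>\<open>J\<close> is the time interval, either compact or the whole line.\<close>

definition trajectory :: "(real^2) set \<Rightarrow> real set \<Rightarrow> (real \<Rightarrow> real^5) \<Rightarrow> (real \<Rightarrow> real^2) \<Rightarrow> bool" where
  "trajectory U J g u \<longleftrightarrow>
     locally_absolutely_continuous_on J g \<and>
     u \<in> borel_measurable (lebesgue_on J) \<and> (\<forall>t\<in>J. u t \<in> U) \<and>
     (AE t\<in>J in lebesgue.
        (g has_vector_derivative (u t $ 1 *\<^sub>R field_X (g t) + u t $ 2 *\<^sub>R field_Y (g t)))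
          (at t within J))"

definition travel_times :: "(real^2) set \<Rightarrow> real^5 \<Rightarrow> real^5 \<Rightarrow> real set" where
  "travel_times U p q = {T. 0 \<le> T \<and> (\<exists>g u. trajectory U {0..T} g u \<and> g 0 = p \<and> g T = q)}"

definition cartan_dist :: "(real^2 \<Rightarrow> real) \<Rightarrow> real^5 \<Rightarrow> real^5 \<Rightarrow> real" where
  "cartan_dist F p q = Inf (travel_times (control_set F) p q)"

definition metric_straight_line :: "(real^2 \<Rightarrow> real) \<Rightarrow> (real \<Rightarrow> real^5) \<Rightarrow> bool" where
  "metric_straight_line F g \<longleftrightarrow> (\<forall>t1 t2. t1 \<le> t2 \<longrightarrow> cartan_dist F (g t1) (g t2) = t2 - t1)"

subsection \<open>Extremals\<close>

text \<open>
  Covectors are identified with their component vectors, so that evaluating a covector on a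
  tangent vector is the inner product.
\<close>

definition momenta :: "real^5 \<Rightarrow> real^5 \<Rightarrow> real^2" where
  "momenta p \<psi> = vector [\<psi> \<bullet> field_X p, \<psi> \<bullet> field_Y p]"

lemma momenta_components:
  "momenta p \<psi> $ 1 = \<psi>$1 - (1/2) * \<psi>$3 * p$2 - (1/12) * \<psi>$4 * p$1 * p$2
      - (1/12) * \<psi>$5 * (p$2)\<^sup>2 - (1/2) * \<psi>$4 * p$3"
  "momenta p \<psi> $ 2 = \<psi>$2 + (1/2) * \<psi>$3 * p$1 + (1/12) * \<psi>$4 * (p$1)\<^sup>2
      + (1/12) * \<psi>$5 * p$1 * p$2 - (1/2) * \<psi>$5 * p$3"
  by (simp_all add: momenta_def inner_vec_def sum_5 field_X_def field_Y_def algebra_simps)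

definition hamiltonian :: "real^5 \<Rightarrow> real^5 \<Rightarrow> real^2 \<Rightarrow> real" where
  "hamiltonian p \<psi> u = momenta p \<psi> $ 1 * u $ 1 + momenta p \<psi> $ 2 * u $ 2"

text \<open>Extremals for the maximum \<open>M = 1\<close> of the Hamiltonian.\<close>

definition extremal ::
  "(real^2 \<Rightarrow> real) \<Rightarrow> (real \<Rightarrow> real^5) \<Rightarrow> (real \<Rightarrow> real^2) \<Rightarrow> (real \<Rightarrow> real^5) \<Rightarrow> bool" where
  "extremal F g u \<psi> \<longleftrightarrow>
     trajectory (control_set F) UNIV g u \<and>
     locally_absolutely_continuous_on UNIV \<psi> \<and> (\<forall>t. \<psi> t \<noteq> 0) \<and>
     (AE t in lebesgue. \<exists>G.
        GDERIV (\<lambda>p. hamiltonian p (\<psi> t) (u t)) (g t) :> G \<and>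
        (\<psi> has_vector_derivative - G) (at t)) \<and>
     (AE t in lebesgue.
        hamiltonian (g t) (\<psi> t) (u t) = support_fun (control_set F) (momenta (g t) (\<psi> t)) \<and>
        support_fun (control_set F) (momenta (g t) (\<psi> t)) = 1)"

text \<open>The continuous angle is determined only up to an integer multiple of \<open>2\<pi>\<close>.\<close>

definition polar_angle ::
  "(real^2 \<Rightarrow> real) \<Rightarrow> (real \<Rightarrow> real^5) \<Rightarrow> (real \<Rightarrow> real^5) \<Rightarrow> (real \<Rightarrow> real) \<Rightarrow> bool" where
  "polar_angle F g \<psi> \<theta> \<longleftrightarrow>
     continuous_on UNIV \<theta> \<and>
     (\<forall>t. momenta (g t) (\<psi> t) $ 1 = polar_radius (control_set F) (\<theta> t) * cos (\<theta> t) \<and>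
          momenta (g t) (\<psi> t) $ 2 = polar_radius (control_set F) (\<theta> t) * sin (\<theta> t))"

end

(*
  If psi_3, psi_4, psi_5 vanish at time 0, the adjoint equations successively force psi_4, psi_5,
  then psi_3, then psi_1, psi_2 to be constant, so (h_1, h_2) = h is a constant vector with
  F_U(h) = 1 and the control takes almost all of its values in the face {u in U. h . u = 1}.
  The functional h_1 x + h_2 y is then a calibration: it grows at rate at most 1 along every
  trajectory and at rate exactly 1 along the extremal, which is therefore a metric straight line.
  The extremals for a given h are all one-parameter subgroups iff the face is a single point, and
  this is equivalent to differentiability of theta |-> F_U(cos theta, sin theta) = 1 / r(theta):
  every point of the face gives a supporting sinusoid at theta_0, and conversely maximizers at
  nearby angles converge to a unique maximizer by compactness.
*)
theory Submission
  imports Defs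
begin

subsection \<open>Absolutely continuous functions\<close>

text \<open>Everything integrated here has a derivative that, off a null set, is constant or bounded
  above by a constant: a component of the covector, the functional h_1 x + h_2 y, a coordinate under
  constant control. A mean value inequality for absolutely continuous functions therefore carries
  the whole analysis. The functional calibrates because X and Y have the constant components (1,0)
  and (0,1) in the directions x, y, so its rate h . u does not depend on the position. The segment
  of the extremal itself, restarted at time 0, attains the infimum that defines the distance. If a
  face contains two distinct points, a control that switches between them at time 0 obeys the same
  constant covector, so the maximum condition alone cannot single out a subgroup.\<close>

lemma absolutely_continuous_fun_onD:
  assumes "absolutely_continuous_fun_on J f" "0 < \<epsilon>"
  obtains \<delta> where "0 < \<delta>"
    "\<And>D S. \<lbrakk>D division_of S; S \<subseteq> J; (\<Sum>k\<in>D. Sup k - Inf k) < \<delta>\<rbrakk>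
       \<Longrightarrow> (\<Sum>k\<in>D. norm (f (Sup k) - f (Inf k))) < \<epsilon>"
  using assms unfolding absolutely_continuous_fun_on_def by meson

lemma division_of_real_intervalE:
  fixes k :: "real set"
  assumes "D division_of S" "k \<in> D"
  obtains s t where "k = {s..t}" "s \<le> t" "{s..t} \<subseteq> S"
  by (metis assms atLeastatMost_empty_iff2 box_real(2) division_ofD(2,3,4))

text \<open>The common source of two closure properties: \<open>h\<close> an inner product with
  \<open>f\<close> gives linear functionals of \<open>f\<close>, and \<open>f\<close> the identity
  gives Lipschitz functions.\<close>

lemma absolutely_continuous_fun_on_dominated:
  fixes f :: "real \<Rightarrow> 'a::real_normed_vector" and h :: "real \<Rightarrow> 'b::real_normed_vector"
  assumes ac: "absolutely_continuous_fun_on J f"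
    and le: "\<And>s t. s \<in> J \<Longrightarrow> t \<in> J \<Longrightarrow> norm (h s - h t) \<le> L * norm (f s - f t)"
  shows "absolutely_continuous_fun_on J h"
  unfolding absolutely_continuous_fun_on_def
proof (intro allI impI)
  fix \<epsilon> :: real assume "0 < \<epsilon>"
  \<comment> \<open>No sign of \<open>L\<close> is assumed, so the divisor is
    \<open>\<bar>L\<bar> + 1\<close>.\<close>
  then have "0 < \<epsilon> / (\<bar>L\<bar> + 1)" by (simp add: add_nonneg_pos)
  from absolutely_continuous_fun_onD[OF ac this] obtain \<delta> where \<delta>: "0 < \<delta>"
    "\<And>D S. \<lbrakk>D division_of S; S \<subseteq> J; (\<Sum>k\<in>D. Sup k - Inf k) < \<delta>\<rbrakk>
       \<Longrightarrow> (\<Sum>k\<in>D. norm (f (Sup k) - f (Inf k))) < \<epsilon> / (\<bar>L\<bar> + 1)" by metis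
  have "(\<Sum>k\<in>D. norm (h (Sup k) - h (Inf k))) < \<epsilon>"
    if D: "D division_of S" "S \<subseteq> J" "(\<Sum>k\<in>D. Sup k - Inf k) < \<delta>" for D S
  proof -
    have "(\<Sum>k\<in>D. norm (h (Sup k) - h (Inf k))) \<le> (\<Sum>k\<in>D. (\<bar>L\<bar> + 1) * norm (f (Sup k) - f (Inf k)))"
    proof (rule sum_mono)
      fix k assume "k \<in> D"
      then obtain s t where k: "k = {s..t}" "s \<le> t" "{s..t} \<subseteq> S"
        using D(1) by (metis division_of_real_intervalE)
      then have "norm (h t - h s) \<le> L * norm (f t - f s)"
        using le D(2) by (auto simp: subset_iff)
      also have "\<dots> \<le> (\<bar>L\<bar> + 1) * norm (f t - f s)"
        by (intro mult_right_mono) auto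
      finally show "norm (h (Sup k) - h (Inf k)) \<le> (\<bar>L\<bar> + 1) * norm (f (Sup k) - f (Inf k))"
        using k by simp
    qed
    also have "\<dots> = (\<bar>L\<bar> + 1) * (\<Sum>k\<in>D. norm (f (Sup k) - f (Inf k)))"
      by (simp add: sum_distrib_left)
    also have "\<dots> < (\<bar>L\<bar> + 1) * (\<epsilon> / (\<bar>L\<bar> + 1))"
      using \<delta>(2)[OF D] by (intro mult_strict_left_mono) auto
    finally show ?thesis by simp
  qed
  with \<delta>(1) show "\<exists>\<delta>>0. \<forall>D S. D division_of S \<and> S \<subseteq> J \<and> (\<Sum>k\<in>D. Sup k - Inf k) < \<delta> \<longrightarrow>
      (\<Sum>k\<in>D. norm (h (Sup k) - h (Inf k))) < \<epsilon>" by blast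
qed

lemma absolutely_continuous_fun_on_id: "absolutely_continuous_fun_on J (\<lambda>t::real. t)"
  unfolding absolutely_continuous_fun_on_def
proof (intro allI impI)
  fix \<epsilon> :: real assume "0 < \<epsilon>"
  moreover have "(\<Sum>k\<in>D. norm (Sup k - Inf k)) = (\<Sum>k\<in>D. Sup k - Inf k)"
    if "D division_of S" for D and S :: "real set"
    using that by (intro sum.cong refl) (metis abs_of_nonneg cInf_atLeastAtMost cSup_atLeastAtMost
        diff_ge_0_iff_ge division_of_real_intervalE real_norm_def)
  ultimately show "\<exists>\<delta>>0. \<forall>D S. D division_of S \<and> S \<subseteq> J \<and> (\<Sum>k\<in>D. Sup k - Inf k) < \<delta> \<longrightarrow>
      (\<Sum>k\<in>D. norm (Sup k - Inf k)) < \<epsilon>" by metis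
qed

lemma absolutely_continuous_fun_on_inner:
  fixes f :: "real \<Rightarrow> 'a::real_inner"
  assumes "absolutely_continuous_fun_on J f"
  shows "absolutely_continuous_fun_on J (\<lambda>t. c \<bullet> f t)"
  by (rule absolutely_continuous_fun_on_dominated[OF assms, where L = "norm c"])
    (simp add: inner_diff_right[symmetric] Cauchy_Schwarz_ineq2)

lemma division_of_shift:
  fixes c :: real
  assumes "D division_of S"
  shows "((`) ((+) c) ` D) division_of ((+) c ` S)"
proof (rule division_ofI)
  note D = division_ofD[OF assms]
  show "finite ((`) ((+) c) ` D)" using D(1) by simp
  show "\<Union> ((`) ((+) c) ` D) = (+) c ` S" using D(6) by auto
  fix K assume "K \<in> (`) ((+) c) ` D"
  then obtain k where k: "k \<in> D" "K = (+) c ` k" by auto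
  show "K \<subseteq> (+) c ` S" "K \<noteq> {}" using k D(2,3) by auto
  show "\<exists>a b. K = cbox a b" using k D(4)[OF k(1)] by (metis cbox_translation)
  fix K' assume "K' \<in> (`) ((+) c) ` D" and ne: "K \<noteq> K'"
  then obtain k' where k': "k' \<in> D" "K' = (+) c ` k'" by auto
  then have "interior k \<inter> interior k' = {}" using D(5) k ne by blast
  then show "interior K \<inter> interior K' = {}"
    using k k' by (simp add: interior_translation) (auto simp: image_Int[symmetric])
qed

text \<open>Allows a segment of an extremal to be restarted at time 0, the form in which
  \<open>travel_times\<close> admits competitors.\<close>

lemma absolutely_continuous_fun_on_shift:
  fixes f :: "real \<Rightarrow> 'a::real_normed_vector"
  assumes "absolutely_continuous_fun_on ((+) c ` J) f"
  shows "absolutely_continuous_fun_on J (\<lambda>t. f (c + t))"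
  unfolding absolutely_continuous_fun_on_def
proof (intro allI impI)
  fix \<epsilon> :: real assume "0 < \<epsilon>"
  from absolutely_continuous_fun_onD[OF assms this] obtain \<delta> where \<delta>: "0 < \<delta>"
    "\<And>D S. \<lbrakk>D division_of S; S \<subseteq> (+) c ` J; (\<Sum>k\<in>D. Sup k - Inf k) < \<delta>\<rbrakk>
       \<Longrightarrow> (\<Sum>k\<in>D. norm (f (Sup k) - f (Inf k))) < \<epsilon>" by metis
  have "(\<Sum>k\<in>D. norm (f (c + Sup k) - f (c + Inf k))) < \<epsilon>"
    if D: "D division_of S" "S \<subseteq> J" "(\<Sum>k\<in>D. Sup k - Inf k) < \<delta>" for D S
  proof -
    have inj: "inj_on ((`) ((+) c)) D"
      by (auto simp: inj_on_def inj_image_eq_iff)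
    have ends: "Sup ((+) c ` k) = c + Sup k" "Inf ((+) c ` k) = c + Inf k" if "k \<in> D" for k
    proof -
      obtain s t where "k = {s..t}" "s \<le> t"
        using D(1) \<open>k \<in> D\<close> by (metis division_of_real_intervalE)
      then show "Sup ((+) c ` k) = c + Sup k" "Inf ((+) c ` k) = c + Inf k" by simp_all
    qed
    have "(\<Sum>k\<in>(`) ((+) c) ` D. Sup k - Inf k) = (\<Sum>k\<in>D. Sup k - Inf k)"
      by (simp add: sum.reindex[OF inj] ends)
    then have "(\<Sum>k\<in>(`) ((+) c) ` D. norm (f (Sup k) - f (Inf k))) < \<epsilon>"
      using D by (intro \<delta>(2)[OF division_of_shift[OF D(1)]]) auto
    then show ?thesis
      by (simp add: sum.reindex[OF inj] ends)
  qed
  with \<delta>(1) show "\<exists>\<delta>>0. \<forall>D S. D division_of S \<and> S \<subseteq> J \<and> (\<Sum>k\<in>D. Sup k - Inf k) < \<delta> \<longrightarrow>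
      (\<Sum>k\<in>D. norm (f (c + Sup k) - f (c + Inf k))) < \<epsilon>" by blast
qed

text \<open>
  Cousin's lemma replaces the Lebesgue integral here: intervals tagged at points of
  differentiability are estimated by the derivative, and those tagged in the exceptional set lie
  in an open set of small measure, where absolute continuity bounds the total increment.
\<close>

lemma absolutely_continuous_increment_le:
  fixes f :: "real \<Rightarrow> real"
  assumes ab: "a \<le> b" and ac: "absolutely_continuous_fun_on {a..b} f"
    and N: "negligible N"
    and deriv: "\<And>t. t \<in> {a..b} - N \<Longrightarrow> \<exists>D\<le>c. (f has_vector_derivative D) (at t within {a..b})"
  shows "f b - f a \<le> c * (b - a)"
proof -
  have main: "f b - f a - c * (b - a) \<le> e * (b - a + 2)" if e: "0 < e" for e
  proof -
    obtain \<delta>0 where \<delta>0: "0 < \<delta>0"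
      "\<And>D S. \<lbrakk>D division_of S; S \<subseteq> {a..b}; (\<Sum>k\<in>D. Sup k - Inf k) < \<delta>0\<rbrakk>
         \<Longrightarrow> (\<Sum>k\<in>D. norm (f (Sup k) - f (Inf k))) < e"
      using absolutely_continuous_fun_onD[OF ac e] by metis
    \<comment> \<open>The second bound makes \<open>\<bar>c\<bar>\<close> times the total length of
      the intervals tagged in \<open>N\<close> at most \<open>e\<close>.\<close>
    define \<delta> where "\<delta> = min \<delta>0 (e / (\<bar>c\<bar> + 1))"
    have \<delta>: "0 < \<delta>" "\<delta> \<le> \<delta>0" "\<bar>c\<bar> * \<delta> \<le> e"
    proof -
      show "0 < \<delta>" using \<delta>0 e by (auto simp: \<delta>_def)
      then have "\<bar>c\<bar> * \<delta> \<le> (\<bar>c\<bar> + 1) * (e / (\<bar>c\<bar> + 1))"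
        by (intro mult_mono) (auto simp: \<delta>_def)
      then show "\<bar>c\<bar> * \<delta> \<le> e" by simp
    qed (simp add: \<delta>_def)
    have Nsets: "N \<in> sets lebesgue"
      using N by (auto simp: negligible_iff_null_sets)
    obtain O' where O': "open O'" "N \<subseteq> O'" "O' - N \<in> lmeasurable"
        "emeasure lebesgue (O' - N) < ennreal \<delta>"
      using sets_lebesgue_outer_open[OF Nsets \<delta>(1)] by metis
    have Nm: "N \<in> lmeasurable" using N by (rule negligible_imp_measurable)
    have Om: "O' \<in> lmeasurable" using O'(2,3) Nm
      by (metis Diff_partition fmeasurable.Un)
    \<comment> \<open>Only \<open>O' - N\<close> was chosen small; since \<open>N\<close> is null,
      \<open>O'\<close> is equally small.\<close>
    have "measure lebesgue O' = measure lebesgue (O' - N)"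
      using measure_Diff_null_set[of O' lebesgue N] N Om by (simp add: negligible_iff_null_sets)
    also have "\<dots> < \<delta>"
      using O'(3,4) \<delta>(1) by (simp add: emeasure_eq_measure2 ennreal_less_iff)
    finally have Omeas: "measure lebesgue O' < \<delta>" .
    \<comment> \<open>One radius function for both kinds of tag. Off \<open>N\<close> it encodes the
      straddle estimate: with the tag between the endpoints, the errors at both ends add up to at
      most \<open>e\<close> times the length.\<close>
    have "\<exists>d>0. (t \<in> N \<longrightarrow> ball t d \<subseteq> O') \<and> (t \<in> {a..b} - N \<longrightarrow>
        (\<forall>s r. s \<le> t \<longrightarrow> t \<le> r \<longrightarrow> {s..r} \<subseteq> ball t d \<inter> {a..b} \<longrightarrow> f r - f s \<le> (c + e) * (r - s)))" for t
    proof (cases "t \<in> {a..b} - N")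
      case True
      then obtain D where D: "D \<le> c" "(f has_vector_derivative D) (at t within {a..b})"
        using deriv by blast
      then obtain d where d: "d > 0" "\<And>y. y \<in> {a..b} \<Longrightarrow> \<bar>y - t\<bar> < d \<Longrightarrow>
          \<bar>f y - f t - (y - t) * D\<bar> \<le> e * \<bar>y - t\<bar>"
        using e unfolding has_vector_derivative_def has_derivative_within_alt by auto
      have "f r - f s \<le> (c + e) * (r - s)"
        if "s \<le> t" "t \<le> r" "{s..r} \<subseteq> ball t d \<inter> {a..b}" for s r
      proof -
        have "r \<in> {s..r}" "s \<in> {s..r}" using that by auto
        then have mem: "r \<in> {a..b}" "s \<in> {a..b}" "\<bar>r - t\<bar> < d" "\<bar>s - t\<bar> < d"
          using that(3) by (auto simp: subset_iff dist_real_def abs_minus_commute)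
        have "f r - f t - (r - t) * D \<le> e * (r - t)"
          using d(2)[OF mem(1,3)] that by auto
        moreover have "- (f s - f t - (s - t) * D) \<le> e * (t - s)"
          using d(2)[OF mem(2,4)] that by auto
        moreover have "D * (r - s) \<le> c * (r - s)"
          using D(1) that by (intro mult_right_mono) auto
        ultimately show ?thesis by (simp add: algebra_simps)
      qed
      with d(1) True show ?thesis by auto
    next
      case False
      show ?thesis
      proof (cases "t \<in> N")
        case True
        then obtain d where "d > 0" "ball t d \<subseteq> O'"
          using O' open_contains_ball by blast
        with False show ?thesis by blast
      next
        case nN: False
        with False show ?thesis by (intro exI[of _ 1]) auto
      qed
    qed
    then obtain d where d: "\<And>t. d t > 0" "\<And>t. t \<in> N \<Longrightarrow> ball t (d t) \<subseteq> O'"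
      "\<And>t s r. t \<in> {a..b} - N \<Longrightarrow> s \<le> t \<Longrightarrow> t \<le> r \<Longrightarrow> {s..r} \<subseteq> ball t (d t) \<inter> {a..b} \<Longrightarrow>
          f r - f s \<le> (c + e) * (r - s)"
      by metis
    have "gauge (\<lambda>t. ball t (d t))" using d(1) by (simp add: gauge_ball_dependent)
    then obtain p where p: "p tagged_division_of {a..b}" "(\<lambda>t. ball t (d t)) fine p"
      by (rule fine_division_exists_real)
    define p1 where "p1 = {(x, K) \<in> p. x \<in> N}"
    have fin: "finite p" using p(1) by blast
    have p1sub: "p1 \<subseteq> p" by (auto simp: p1_def)
    have p1part: "p1 tagged_partial_division_of {a..b}"
      using p(1) p1sub by (meson tagged_division_of_def tagged_partial_division_subset)
    define D where "D = snd ` p1"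
    have Ddiv: "D division_of \<Union>D"
      unfolding D_def by (rule partial_division_of_tagged_division[OF p1part])
    have Dsub: "\<Union>D \<subseteq> {a..b}"
      using tagged_partial_division_ofD(3)[OF p1part] unfolding D_def by force
    have DO: "\<Union>D \<subseteq> O'"
      using p(2) d(2) by (fastforce simp: D_def p1_def fine_def)
    have "(\<Sum>k\<in>D. Sup k - Inf k) = (\<Sum>k\<in>D. measure lebesgue k)"
    proof (rule sum.cong[OF refl])
      fix k assume "k \<in> D"
      then obtain s t where "k = {s..t}" "s \<le> t"
        using Ddiv by (metis division_of_real_intervalE)
      then show "Sup k - Inf k = measure lebesgue k" by simp
    qed
    also have "\<dots> = measure lebesgue (\<Union>D)"
      using content_division[OF Ddiv] Ddiv by auto
    also have "\<dots> \<le> measure lebesgue O'"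
      using DO Om lmeasurable_division[OF Ddiv] by (intro measure_mono_fmeasurable) auto
    finally have Dlen: "(\<Sum>k\<in>D. Sup k - Inf k) < \<delta>" using Omeas by linarith
    have Df: "(\<Sum>k\<in>D. \<bar>f (Sup k) - f (Inf k)\<bar>) \<le> e"
      using \<delta>0(2)[OF Ddiv Dsub] Dlen \<delta>(2) by auto
    let ?g = "\<lambda>K. \<bar>f (Sup K) - f (Inf K)\<bar> + \<bar>c\<bar> * (Sup K - Inf K)"
    \<comment> \<open>Forgetting the tags may merge intervals only if they are degenerate, and the
      reindexing rule demands the value 0 on these. The empty set counts among them, and there
      \<open>Sup\<close> and \<open>Inf\<close> have no useful value, so 0 is imposed.\<close>
    let ?g' = "\<lambda>K. if K = {} then 0 else ?g K"
    have "(x, {}) \<notin> p1" for x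
      using tagged_partial_division_ofD(2)[OF p1part, of x "{}"] by blast
    then have "(\<Sum>(x,K)\<in>p1. ?g K) = (\<Sum>(x,K)\<in>p1. ?g' K)"
      by (intro sum.cong refl) auto
    also have "\<dots> = (\<Sum>K\<in>D. ?g' K)"
      unfolding D_def
    proof (rule sum.over_tagged_division_lemma[OF tagged_partial_division_of_Union_self[OF p1part]])
      fix u v :: real assume "box u v = {}"
      then have "v \<le> u" by simp
      then show "?g' (cbox u v) = 0" by (cases "u = v") auto
    qed
    also have "\<dots> = (\<Sum>K\<in>D. ?g K)"
      using division_ofD(3)[OF Ddiv] by (intro sum.cong) auto
    also have "\<dots> = (\<Sum>k\<in>D. \<bar>f (Sup k) - f (Inf k)\<bar>) + \<bar>c\<bar> * (\<Sum>k\<in>D. Sup k - Inf k)"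
      by (simp add: sum.distrib sum_distrib_left)
    also have "\<dots> \<le> e + \<bar>c\<bar> * \<delta>"
      using Df Dlen by (intro add_mono mult_left_mono) auto
    finally have bad: "(\<Sum>(x,K)\<in>p1. ?g K) \<le> 2 * e" using \<delta>(3) by linarith
    have "f b - f a - c * (b - a) = (\<Sum>(x,K)\<in>p. f (Sup K) - f (Inf K)) - c * (\<Sum>(x,K)\<in>p. Sup K - Inf K)"
      using additive_tagged_division_1[OF ab p(1), of f]
        additive_tagged_division_1[OF ab p(1), of "\<lambda>x. x"] by simp
    also have "\<dots> = (\<Sum>(x,K)\<in>p. f (Sup K) - f (Inf K) - c * (Sup K - Inf K))"
      by (simp add: sum_distrib_left sum_subtractf[symmetric] case_prod_unfold)
    \<comment> \<open>A tag off \<open>N\<close> costs at most \<open>e\<close> times the length of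
      its interval. A tag in \<open>N\<close> is charged the crude amount \<open>?g\<close>, whose
      total is bounded by \<open>bad\<close>.\<close>
    also have "\<dots> \<le> (\<Sum>(x,K)\<in>p. e * (Sup K - Inf K) + (if x \<in> N then ?g K else 0))"
    proof (rule sum_mono, clarify)
      fix x K assume xK: "(x, K) \<in> p"
      obtain s r where K: "K = {s..r}" using tagged_division_ofD(4)[OF p(1) xK] by auto
      have x: "s \<le> x" "x \<le> r" "{s..r} \<subseteq> ball x (d x) \<inter> {a..b}"
        using tagged_division_ofD(2,3)[OF p(1) xK] p(2) xK K by (auto simp: fine_def)
      show "f (Sup K) - f (Inf K) - c * (Sup K - Inf K)
          \<le> e * (Sup K - Inf K) + (if x \<in> N then ?g K else 0)"
      proof (cases "x \<in> N")
        case True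
        have "- (c * (r - s)) \<le> \<bar>c\<bar> * (r - s)"
          using mult_right_mono[of "- c" "\<bar>c\<bar>" "r - s"] x by simp
        moreover have "0 \<le> e * (r - s)" using e x by auto
        ultimately show ?thesis using True x K by auto
      next
        case False
        have "x \<in> {a..b}" using x by auto
        then have "f r - f s \<le> (c + e) * (r - s)" using d(3) False x by blast
        then show ?thesis using False K x by (auto simp: algebra_simps)
      qed
    qed
    also have "\<dots> = e * (\<Sum>(x,K)\<in>p. Sup K - Inf K) + (\<Sum>(x,K)\<in>p. if x \<in> N then ?g K else 0)"
      by (simp add: sum_distrib_left sum.distrib case_prod_unfold)
    also have "(\<Sum>(x,K)\<in>p. Sup K - Inf K) = b - a"
      using additive_tagged_division_1[OF ab p(1), of "\<lambda>x. x"] .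
    also have "(\<Sum>(x,K)\<in>p. if x \<in> N then ?g K else 0) = (\<Sum>(x,K)\<in>p1. ?g K)"
      using fin by (intro sum.mono_neutral_cong_right) (auto simp: p1_def split: if_splits)
    also have "e * (b - a) + \<dots> \<le> e * (b - a) + 2 * e" using bad by simp
    finally show ?thesis by (simp add: algebra_simps)
  qed
  show ?thesis
  proof (rule ccontr)
    assume neg: "\<not> ?thesis"
    \<comment> \<open>\<open>k\<close> is the supposed excess and \<open>m\<close> the factor of
      \<open>e\<close> in \<open>main\<close>; the choice \<open>e = k / (2 * m)\<close> yields
      \<open>k \<le> k / 2\<close>.\<close>
    define k m where "k = f b - f a - c * (b - a)" and "m = b - a + 2"
    have km: "0 < k" "0 < m" using neg ab by (auto simp: k_def m_def)
    then have "k \<le> k / (2 * m) * m"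
      using main[of "k / (2 * m)"] by (simp add: k_def[symmetric] m_def[symmetric])
    with km show False by simp
  qed
qed

text \<open>Testing with \<open>w\<close> and with \<open>- w\<close> turns the one-sided estimate
  into an equation in every direction.\<close>

lemma absolutely_continuous_increment_eq:
  fixes f :: "real \<Rightarrow> 'a::euclidean_space"
  assumes ab: "a \<le> b" and ac: "absolutely_continuous_fun_on {a..b} f"
    and N: "negligible N"
    and deriv: "\<And>t. t \<in> {a..b} - N \<Longrightarrow> (f has_vector_derivative c) (at t within {a..b})"
  shows "f b - f a = (b - a) *\<^sub>R c"
proof -
  have le: "w \<bullet> f b - w \<bullet> f a \<le> (w \<bullet> c) * (b - a)" for w
  proof (rule absolutely_continuous_increment_le[OF ab absolutely_continuous_fun_on_inner[OF ac] N])
    fix t assume "t \<in> {a..b} - N"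
    then have "((\<lambda>t. w \<bullet> f t) has_vector_derivative w \<bullet> c) (at t within {a..b})"
      using deriv bounded_linear.has_vector_derivative[OF bounded_linear_inner_right] by blast
    then show "\<exists>D\<le>w \<bullet> c. ((\<lambda>t. w \<bullet> f t) has_vector_derivative D) (at t within {a..b})" by blast
  qed
  show ?thesis
  proof (rule euclidean_eqI)
    fix w :: 'a
    show "(f b - f a) \<bullet> w = ((b - a) *\<^sub>R c) \<bullet> w"
      using le[of w] le[of "- w"] by (simp add: inner_commute inner_diff_right algebra_simps)
  qed
qed

subsection \<open>Support functions in the plane\<close>

text \<open>Subadditivity and positive homogeneity give convexity, and a finite convex function on
  the whole plane is continuous.\<close>

lemma quasinorm_continuous:
  assumes "quasinorm F"
  shows "continuous_on S F"
proof -
  have "convex_on UNIV F"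
  proof (rule convex_onI)
    fix t :: real and x y :: "real^2"
    assume "0 < t" "t < 1"
    have "F ((1 - t) *\<^sub>R x + t *\<^sub>R y) \<le> F ((1 - t) *\<^sub>R x) + F (t *\<^sub>R y)"
      using assms by (simp add: quasinorm_def)
    also have "\<dots> = (1 - t) * F x + t * F y"
      using assms \<open>0 < t\<close> \<open>t < 1\<close> by (simp add: quasinorm_def)
    finally show "F ((1 - t) *\<^sub>R x + t *\<^sub>R y) \<le> (1 - t) * F x + t * F y" .
  qed simp
  then show ?thesis
    using convex_on_continuous[of UNIV F] continuous_on_subset by blast
qed

text \<open>The constant is the minimum of \<open>F\<close> on the unit circle, positive by
  definiteness. Only positive factors \<open>1 / norm x\<close> are pulled out of \<open>F\<close>,
  in keeping with its possible asymmetry.\<close>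

lemma quasinorm_lower_bound:
  assumes "quasinorm F"
  obtains m where "0 < m" "\<And>x. m * norm x \<le> F x"
proof -
  have "compact (sphere (0::real^2) 1)" "sphere (0::real^2) 1 \<noteq> {}" by simp_all
  then obtain e where e: "norm e = 1" "\<And>y. norm y = 1 \<Longrightarrow> F e \<le> F y"
    using continuous_attains_inf[OF _ _ quasinorm_continuous[OF assms]] by (metis mem_sphere_0)
  have F: "\<And>x. 0 \<le> F x" "\<And>x. F x = 0 \<longleftrightarrow> x = 0" "\<And>c x. 0 \<le> c \<Longrightarrow> F (c *\<^sub>R x) = c * F x"
    using assms by (auto simp: quasinorm_def)
  show thesis
  proof (rule that)
    show "0 < F e" using e(1) F(1)[of e] F(2)[of e] by (metis less_le norm_zero zero_neq_one)
    fix x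
    show "F e * norm x \<le> F x"
    proof (cases "x = 0")
      case False
      then have "F e \<le> F ((1 / norm x) *\<^sub>R x)" by (intro e(2)) simp
      also have "\<dots> = F x / norm x" by (simp add: F(3))
      finally show ?thesis using False by (simp add: field_simps)
    qed (use F(1) in simp)
  qed
qed

lemma compact_control_set:
  assumes "quasinorm F"
  shows "compact (control_set F)"
proof -
  obtain m where m: "0 < m" "\<And>x. m * norm x \<le> F x"
    using quasinorm_lower_bound[OF assms] by metis
  have "control_set F \<subseteq> cball 0 (1 / m)"
  proof
    fix x assume "x \<in> control_set F"
    then have "m * norm x \<le> 1" using m(2)[of x] by (simp add: control_set_def)
    then show "x \<in> cball 0 (1 / m)" using m(1) by (simp add: field_simps)
  qed
  then have "bounded (control_set F)" using bounded_cball bounded_subset by blast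
  moreover have "closed (control_set F)"
    unfolding control_set_def
    using closed_Collect_le[OF quasinorm_continuous[OF assms] continuous_on_const] by simp
  ultimately show ?thesis by (simp add: compact_eq_bounded_closed)
qed

text \<open>The witness is \<open>h\<close> itself, rescaled to \<open>F\<close>-value 1. This makes
  the support function positive away from the origin, on which the polar equation rests.\<close>

lemma control_set_direction:
  assumes "quasinorm F" "h \<noteq> 0"
  shows "\<exists>u\<in>control_set F. 0 < h \<bullet> u"
proof
  have "0 < F h" using assms by (metis less_le quasinorm_def)
  then show "(1 / F h) *\<^sub>R h \<in> control_set F" "0 < h \<bullet> ((1 / F h) *\<^sub>R h)"
    using assms by (auto simp: control_set_def quasinorm_def)
qed

lemma zero_in_control_set: "quasinorm F \<Longrightarrow> 0 \<in> control_set F"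
  by (metis control_set_def mem_Collect_eq quasinorm_def zero_le_one)

lemma support_fun_attained:
  assumes "compact U" "U \<noteq> {}"
  obtains u where "u \<in> U" "h \<bullet> u = support_fun U h" "\<And>v. v \<in> U \<Longrightarrow> h \<bullet> v \<le> support_fun U h"
proof -
  have "\<exists>u\<in>U. \<forall>v\<in>U. h \<bullet> v \<le> h \<bullet> u"
    by (intro continuous_attains_sup assms continuous_intros)
  then obtain u where u: "u \<in> U" "\<And>v. v \<in> U \<Longrightarrow> h \<bullet> v \<le> h \<bullet> u"
    by blast
  then have "support_fun U h = h \<bullet> u"
    unfolding support_fun_def by (intro cSup_eq_maximum) auto
  with u that show thesis by metis
qed

lemma inner_le_support_fun: "compact U \<Longrightarrow> v \<in> U \<Longrightarrow> h \<bullet> v \<le> support_fun U h"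
  by (metis empty_iff support_fun_attained)

lemma support_fun_scaleR:
  assumes "compact U" "U \<noteq> {}" "0 \<le> c"
  shows "support_fun U (c *\<^sub>R h) = c * support_fun U h"
proof -
  obtain u where u: "u \<in> U" "h \<bullet> u = support_fun U h" "\<And>v. v \<in> U \<Longrightarrow> h \<bullet> v \<le> support_fun U h"
    using support_fun_attained[OF assms(1,2)] by metis
  have "support_fun U (c *\<^sub>R h) = (c *\<^sub>R h) \<bullet> u"
    unfolding support_fun_def
  proof (rule cSup_eq_maximum)
    show "(c *\<^sub>R h) \<bullet> u \<in> (\<bullet>) (c *\<^sub>R h) ` U" using u(1) by blast
    show "x \<le> (c *\<^sub>R h) \<bullet> u" if "x \<in> (\<bullet>) (c *\<^sub>R h) ` U" for x
      using that u(2,3) assms(3) by (auto intro: mult_left_mono)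
  qed
  then show ?thesis using u(2) by simp
qed

lemma support_fun_pos:
  assumes "quasinorm F" "h \<noteq> 0"
  shows "0 < support_fun (control_set F) h"
  using control_set_direction[OF assms] inner_le_support_fun[OF compact_control_set[OF assms(1)]]
  by (meson less_le_trans)

section \<open>Polar coordinates and the polar radius\<close>

definition unit_vec :: "real \<Rightarrow> real^2" where
  "unit_vec \<theta> = vector [cos \<theta>, sin \<theta>]"

lemma unit_vec_components [simp]: "unit_vec \<theta> $ 1 = cos \<theta>" "unit_vec \<theta> $ 2 = sin \<theta>"
  by (simp_all add: unit_vec_def)

lemma scaleR_unit_vec: "vector [\<rho> * cos \<theta>, \<rho> * sin \<theta>] = \<rho> *\<^sub>R unit_vec \<theta>"
  by (simp add: vec_eq_iff forall_2)

lemma inner_real2: "(a :: real^2) \<bullet> b = a $ 1 * b $ 1 + a $ 2 * b $ 2"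
  by (simp add: inner_vec_def sum_2)

lemma norm_unit_vec [simp]: "norm (unit_vec \<theta>) = 1"
  by (simp add: norm_eq_sqrt_inner inner_real2 power2_eq_square[symmetric])

lemma unit_vec_nonzero [simp]: "unit_vec \<theta> \<noteq> 0"
  by (metis norm_unit_vec norm_zero zero_neq_one)

lemma real2_polarE:
  obtains \<theta> where "h = norm h *\<^sub>R unit_vec \<theta>"
proof -
  obtain r \<theta> where "0 \<le> r" "Complex (h $ 1) (h $ 2) = rcis r \<theta>"
    by (metis norm_ge_zero rcis_cmod_Arg)
  then have "h = r *\<^sub>R unit_vec \<theta>" "0 \<le> r"
    by (simp_all add: vec_eq_iff forall_2 complex_eq_iff)
  then have "h = norm h *\<^sub>R unit_vec \<theta>" by simp
  with that show thesis .
qed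

text \<open>The chord is at most the arc: the chord has length
  \<open>2 * \<bar>sin ((\<theta> - \<phi>) / 2)\<bar>\<close>.\<close>

lemma norm_unit_vec_diff: "norm (unit_vec \<theta> - unit_vec \<phi>) \<le> \<bar>\<theta> - \<phi>\<bar>"
proof -
  have "norm (unit_vec \<theta> - unit_vec \<phi>) ^ 2 = 2 - 2 * cos (\<theta> - \<phi>)"
    using sin_cos_squared_add[of \<theta>] sin_cos_squared_add[of \<phi>]
    unfolding power2_norm_eq_inner
    by (simp add: inner_real2 cos_diff algebra_simps power2_eq_square)
  also have "\<dots> = 4 * sin ((\<theta> - \<phi>) / 2) ^ 2"
  proof -
    have "2 * ((\<theta> - \<phi>) / 2) = \<theta> - \<phi>" by simp
    from cos_double_sin[of "(\<theta> - \<phi>) / 2", unfolded this] show ?thesis by simp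
  qed
  also have "\<dots> \<le> \<bar>\<theta> - \<phi>\<bar> ^ 2"
    using power_mono[OF abs_sin_x_le_abs_x[of "(\<theta> - \<phi>) / 2"], of 2]
    by (simp add: power_divide)
  finally show ?thesis
    by (rule power2_le_imp_le) simp
qed

text \<open>By homogeneity the condition under the description operator is linear in \<rho> with a
  positive coefficient, so it has exactly one solution.\<close>

lemma polar_radius_eq:
  assumes "quasinorm F"
  shows "polar_radius (control_set F) \<theta> = 1 / support_fun (control_set F) (unit_vec \<theta>)"
proof -
  let ?s = "support_fun (control_set F) (unit_vec \<theta>)"
  have s: "0 < ?s" using assms by (simp add: support_fun_pos)
  have "support_fun (control_set F) (\<rho> *\<^sub>R unit_vec \<theta>) = \<rho> * ?s" if "0 < \<rho>" for \<rho>
    using compact_control_set[OF assms] zero_in_control_set[OF assms] that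
    by (intro support_fun_scaleR) auto
  then show ?thesis
    unfolding polar_radius_def scaleR_unit_vec using s
    by (intro the_equality) (auto simp: field_simps)
qed

lemma polar_radius_pos: "quasinorm F \<Longrightarrow> 0 < polar_radius (control_set F) \<theta>"
  by (simp add: polar_radius_eq support_fun_pos)

lemma support_fun_polar_radius:
  assumes "quasinorm F"
  shows "support_fun (control_set F) (polar_radius (control_set F) \<theta> *\<^sub>R unit_vec \<theta>) = 1"
  using support_fun_scaleR[OF compact_control_set[OF assms], of "polar_radius (control_set F) \<theta>" "unit_vec \<theta>"]
    zero_in_control_set[OF assms] polar_radius_pos[OF assms, of \<theta>]
    support_fun_pos[OF assms, of "unit_vec \<theta>"]
  by (auto simp: polar_radius_eq[OF assms])

text \<open>Assumes only \<rho> \<ge> 0 since \<rho> will be a norm; \<rho> = 0 is excluded because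
  the support function vanishes at the origin.\<close>

lemma polar_radius_unique:
  assumes "quasinorm F" "0 \<le> \<rho>" "support_fun (control_set F) (\<rho> *\<^sub>R unit_vec \<theta>) = 1"
  shows "polar_radius (control_set F) \<theta> = \<rho>"
  using support_fun_scaleR[OF compact_control_set[OF assms(1)], of \<rho> "unit_vec \<theta>"] assms
    zero_in_control_set[OF assms(1)] support_fun_pos[OF assms(1), of "unit_vec \<theta>"]
  by (auto simp: polar_radius_eq field_simps)

lemma has_real_derivative_unit_vec_inner:
  "((\<lambda>\<theta>. unit_vec \<theta> \<bullet> u) has_real_derivative (cos \<theta> * u $ 2 - sin \<theta> * u $ 1)) (at \<theta>)"
  unfolding inner_real2 unit_vec_components
  by (auto intro!: derivative_eq_intros)

section \<open>Differentiability of the support function and uniqueness of maximizers\<close>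

lemma real_derivative_supporting_unique:
  fixes f l :: "real \<Rightarrow> real"
  assumes f: "(f has_real_derivative D) (at x)" and l: "(l has_real_derivative E) (at x)"
    and le: "\<And>y. l y \<le> f y" and eq: "l x = f x"
  shows "D = E"
proof -
  have "((\<lambda>y. f y - l y) has_real_derivative D - E) (at x)"
    by (intro derivative_intros f l)
  then have "D - E = 0"
    by (rule DERIV_local_min[of _ _ _ 1]) (use le eq in auto)
  then show ?thesis by simp
qed

text \<open>A quantitative compactness argument: among controls at distance at least
  \<open>e\<close> from \<open>u0\<close> the best value at \<open>\<theta>0\<close> misses the
  maximum by a positive gap, and a small rotation of the direction cannot make up for the
  gap.\<close>

lemma maximizers_near_unique_maximizer:
  assumes U: "compact U" and u0: "u0 \<in> U"
    and uniq: "\<And>u. u \<in> U \<Longrightarrow> unit_vec \<theta>0 \<bullet> u = support_fun U (unit_vec \<theta>0) \<Longrightarrow> u = u0"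
    and e: "0 < e"
  obtains d where "0 < d" "\<And>\<theta> u. \<bar>\<theta> - \<theta>0\<bar> < d \<Longrightarrow> u \<in> U \<Longrightarrow>
      unit_vec \<theta> \<bullet> u = support_fun U (unit_vec \<theta>) \<Longrightarrow> norm (u - u0) < e"
proof (cases "U - ball u0 e = {}")
  case True
  show ?thesis
    by (rule that[of 1]) (use True in \<open>auto simp: dist_norm norm_minus_commute\<close>)
next
  case False
  let ?s = "\<lambda>\<theta>. support_fun U (unit_vec \<theta>)"
  have attained: "unit_vec \<theta>0 \<bullet> u0 = ?s \<theta>0"
    using support_fun_attained[OF U, of "unit_vec \<theta>0"] u0 uniq by (metis empty_iff)
  have "\<exists>w\<in>U - ball u0 e. \<forall>v\<in>U - ball u0 e. unit_vec \<theta>0 \<bullet> v \<le> unit_vec \<theta>0 \<bullet> w"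
    by (intro continuous_attains_sup compact_diff U open_ball False continuous_intros)
  then obtain w where w: "w \<in> U - ball u0 e"
    "\<And>v. v \<in> U - ball u0 e \<Longrightarrow> unit_vec \<theta>0 \<bullet> v \<le> unit_vec \<theta>0 \<bullet> w"
    by blast
  have "unit_vec \<theta>0 \<bullet> w \<noteq> ?s \<theta>0" using uniq w(1) e by auto
  then have gap: "unit_vec \<theta>0 \<bullet> w < ?s \<theta>0"
    using inner_le_support_fun[OF U, of w "unit_vec \<theta>0"] w(1) by auto
  obtain B where B: "0 < B" "\<And>u. u \<in> U \<Longrightarrow> norm u \<le> B"
    using compact_imp_bounded[OF U] by (metis bounded_pos)
  \<comment> \<open>With \<open>B\<close> bounding the norms in \<open>U\<close>, a rotation by less
    than \<open>d\<close> changes every inner product by less than half the gap. Both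
    \<open>u\<close> and \<open>u0\<close> are moved, so the two halves just use up the gap.\<close>
  define d where "d = (?s \<theta>0 - unit_vec \<theta>0 \<bullet> w) / (2 * B)"
  show ?thesis
  proof (rule that)
    show "0 < d" using gap B by (simp add: d_def)
    fix \<theta> u assume d: "\<bar>\<theta> - \<theta>0\<bar> < d" and u: "u \<in> U" "unit_vec \<theta> \<bullet> u = ?s \<theta>"
    have close: "\<bar>unit_vec \<theta> \<bullet> v - unit_vec \<theta>0 \<bullet> v\<bar> < (?s \<theta>0 - unit_vec \<theta>0 \<bullet> w) / 2" if "v \<in> U" for v
    proof -
      have "\<bar>(unit_vec \<theta> - unit_vec \<theta>0) \<bullet> v\<bar> \<le> norm (unit_vec \<theta> - unit_vec \<theta>0) * norm v"
        by (rule Cauchy_Schwarz_ineq2)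
      also have "\<dots> \<le> \<bar>\<theta> - \<theta>0\<bar> * B"
        using norm_unit_vec_diff B(2)[OF that] by (intro mult_mono) auto
      also have "\<dots> < d * B" using d B(1) by simp
      finally show ?thesis using B(1) by (simp add: d_def inner_diff_left)
    qed
    show "norm (u - u0) < e"
    proof (rule ccontr)
      assume "\<not> ?thesis"
      then have "unit_vec \<theta>0 \<bullet> u \<le> unit_vec \<theta>0 \<bullet> w"
        using w(2) u(1) by (auto simp: dist_norm norm_minus_commute)
      moreover have "unit_vec \<theta> \<bullet> u0 \<le> unit_vec \<theta> \<bullet> u"
        using inner_le_support_fun[OF U u0] u(2) by simp
      ultimately show False
        using close[OF u(1)] close[OF u0] attained unfolding abs_less_iff by argo
    qed
  qed
qed

lemma support_fun_differentiable_iff: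
  assumes U: "compact U" "U \<noteq> {}"
  shows "(\<lambda>\<theta>. support_fun U (unit_vec \<theta>)) differentiable at \<theta>0 \<longleftrightarrow>
    (\<exists>!u. u \<in> U \<and> unit_vec \<theta>0 \<bullet> u = support_fun U (unit_vec \<theta>0))"
    (is "?s differentiable _ \<longleftrightarrow> _")
proof
  assume "?s differentiable at \<theta>0"
  then obtain D where D: "(?s has_real_derivative D) (at \<theta>0)"
    by (auto simp: real_differentiable_def)
  \<comment> \<open>For every maximizer \<open>u\<close> the sinusoid
    \<open>unit_vec \<theta> \<bullet> u\<close> lies below the support function and touches it at
    \<open>\<theta>0\<close>.\<close>
  have *: "D = cos \<theta>0 * u $ 2 - sin \<theta>0 * u $ 1" if "u \<in> U" "unit_vec \<theta>0 \<bullet> u = ?s \<theta>0" for u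
    using D has_real_derivative_unit_vec_inner
    by (rule real_derivative_supporting_unique) (use U that in \<open>auto intro: inner_le_support_fun\<close>)
  have "u = v"
    if "u \<in> U" "unit_vec \<theta>0 \<bullet> u = ?s \<theta>0" "v \<in> U" "unit_vec \<theta>0 \<bullet> v = ?s \<theta>0" for u v
  proof -
    define a where "a = u - v"
    \<comment> \<open>The derivative fixes the component of a maximizer along (-sin, cos), the
      maximum its component along (cos, sin); rotating back shows that the difference
      \<open>a\<close> is 0.\<close>
    have 1: "cos \<theta>0 * a $ 2 - sin \<theta>0 * a $ 1 = 0"
      using *[of u] *[of v] that by (simp add: a_def algebra_simps)
    have 2: "cos \<theta>0 * a $ 1 + sin \<theta>0 * a $ 2 = 0"
      using that by (simp add: a_def inner_real2 algebra_simps)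
    have "a $ 1 = cos \<theta>0 * (cos \<theta>0 * a $ 1 + sin \<theta>0 * a $ 2)
        - sin \<theta>0 * (cos \<theta>0 * a $ 2 - sin \<theta>0 * a $ 1)"
      using arg_cong[OF sin_cos_squared_add3[of \<theta>0], of "\<lambda>t. t * a $ 1"]
      by (simp add: algebra_simps del: sin_cos_squared_add3)
    moreover have "a $ 2 = sin \<theta>0 * (cos \<theta>0 * a $ 1 + sin \<theta>0 * a $ 2)
        + cos \<theta>0 * (cos \<theta>0 * a $ 2 - sin \<theta>0 * a $ 1)"
      using arg_cong[OF sin_cos_squared_add3[of \<theta>0], of "\<lambda>t. t * a $ 2"]
      by (simp add: algebra_simps del: sin_cos_squared_add3)
    ultimately have "a = 0" unfolding 1 2 by (simp add: vec_eq_iff forall_2)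
    then show ?thesis by (simp add: a_def)
  qed
  then show "\<exists>!u. u \<in> U \<and> unit_vec \<theta>0 \<bullet> u = ?s \<theta>0"
    using support_fun_attained[OF U, of "unit_vec \<theta>0"] by metis
next
  assume "\<exists>!u. u \<in> U \<and> unit_vec \<theta>0 \<bullet> u = ?s \<theta>0"
  then obtain u0 where u0: "u0 \<in> U" "unit_vec \<theta>0 \<bullet> u0 = ?s \<theta>0"
    "\<And>u. u \<in> U \<Longrightarrow> unit_vec \<theta>0 \<bullet> u = ?s \<theta>0 \<Longrightarrow> u = u0" by metis
  let ?l = "\<lambda>\<theta>. unit_vec \<theta> \<bullet> u0"
  have "((\<lambda>\<theta>. ?s \<theta> - ?l \<theta>) has_derivative (\<lambda>_. 0)) (at \<theta>0)"
    unfolding has_derivative_at_alt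
  proof (intro conjI allI impI)
    fix e :: real assume "0 < e"
    then obtain d where d: "0 < d" "\<And>\<theta> u. \<bar>\<theta> - \<theta>0\<bar> < d \<Longrightarrow> u \<in> U \<Longrightarrow>
        unit_vec \<theta> \<bullet> u = ?s \<theta> \<Longrightarrow> norm (u - u0) < e"
      using maximizers_near_unique_maximizer[OF U(1) u0(1,3)] by metis
    have "norm (?s \<theta> - ?l \<theta> - (?s \<theta>0 - ?l \<theta>0) - 0) \<le> e * norm (\<theta> - \<theta>0)"
      if near: "norm (\<theta> - \<theta>0) < d" for \<theta>
    proof -
      obtain u where u: "u \<in> U" "unit_vec \<theta> \<bullet> u = ?s \<theta>"
        using support_fun_attained[OF U, of "unit_vec \<theta>"] by metis
      \<comment> \<open>The second summand is at most 0, as \<open>u\<close> merely competes at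
        \<open>\<theta>0\<close>. The first is bounded by
        \<open>\<bar>\<theta> - \<theta>0\<bar>\<close> times a quantity tending to 0, so the
        support function is tangent to the sinusoid of \<open>u0\<close>.\<close>
      have "?s \<theta> - ?l \<theta> = (unit_vec \<theta> - unit_vec \<theta>0) \<bullet> (u - u0) + (unit_vec \<theta>0 \<bullet> u - ?s \<theta>0)"
        using u(2) u0(2) by (simp add: inner_diff_left inner_diff_right)
      also have "\<dots> \<le> norm (unit_vec \<theta> - unit_vec \<theta>0) * norm (u - u0) + 0"
        by (intro add_mono norm_cauchy_schwarz) (use inner_le_support_fun[OF U(1) u(1)] in simp)
      also have "\<dots> \<le> \<bar>\<theta> - \<theta>0\<bar> * e + 0"
        using norm_unit_vec_diff d(2)[OF _ u] near \<open>0 < e\<close>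
        by (intro add_mono mult_mono) (auto intro: less_imp_le)
      finally have "?s \<theta> - ?l \<theta> \<le> e * \<bar>\<theta> - \<theta>0\<bar>" by (simp add: mult.commute)
      moreover have "0 \<le> ?s \<theta> - ?l \<theta>"
        using inner_le_support_fun[OF U(1) u0(1)] by simp
      ultimately show ?thesis using u0(2) by simp
    qed
    with d(1) show "\<exists>d>0. \<forall>\<theta>. norm (\<theta> - \<theta>0) < d \<longrightarrow>
        norm (?s \<theta> - ?l \<theta> - (?s \<theta>0 - ?l \<theta>0) - 0) \<le> e * norm (\<theta> - \<theta>0)" by blast
  qed simp
  then have "(\<lambda>\<theta>. ?s \<theta> - ?l \<theta>) differentiable at \<theta>0"
    by (auto simp: differentiable_def)
  moreover have "?l differentiable at \<theta>0"
    using has_real_derivative_unit_vec_inner real_differentiable_def by blast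
  ultimately have "(\<lambda>\<theta>. (?s \<theta> - ?l \<theta>) + ?l \<theta>) differentiable at \<theta>0"
    by (rule differentiable_add)
  then show "?s differentiable at \<theta>0" by simp
qed

text \<open>The radius and the support function on unit vectors are nonvanishing reciprocals of each
  other. Multiplying the direction by the radius normalizes the maximum to 1, as for
  extremals.\<close>

lemma polar_radius_differentiable_iff:
  assumes "quasinorm F"
  shows "polar_radius (control_set F) differentiable at \<theta>0 \<longleftrightarrow>
    (\<exists>!u. u \<in> control_set F \<and> (polar_radius (control_set F) \<theta>0 *\<^sub>R unit_vec \<theta>0) \<bullet> u = 1)"
proof -
  let ?s = "\<lambda>\<theta>. support_fun (control_set F) (unit_vec \<theta>)" and ?r = "polar_radius (control_set F)"
  have s: "?s \<theta> \<noteq> 0" for \<theta> using support_fun_pos[OF assms, of "unit_vec \<theta>"] by simp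
  have r: "?r = (\<lambda>\<theta>. inverse (?s \<theta>))" and s': "?s = (\<lambda>\<theta>. inverse (?r \<theta>))"
    using polar_radius_eq[OF assms] by (auto simp: fun_eq_iff field_simps)
  have r0: "?r \<theta>0 \<noteq> 0" using polar_radius_pos[OF assms, of \<theta>0] by simp
  have "?r differentiable at \<theta>0 \<longleftrightarrow> ?s differentiable at \<theta>0"
  proof
    assume "?r differentiable at \<theta>0"
    from differentiable_inverse[OF this r0] show "?s differentiable at \<theta>0"
      by (simp only: s'[symmetric])
  next
    assume "?s differentiable at \<theta>0"
    from differentiable_inverse[OF this s] show "?r differentiable at \<theta>0"
      by (simp only: r[symmetric])
  qed
  also have "\<dots> \<longleftrightarrow> (\<exists>!u. u \<in> control_set F \<and> unit_vec \<theta>0 \<bullet> u = ?s \<theta>0)"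
    using assms compact_control_set zero_in_control_set
    by (intro support_fun_differentiable_iff) auto
  also have "\<dots> \<longleftrightarrow> (\<exists>!u. u \<in> control_set F \<and> (?r \<theta>0 *\<^sub>R unit_vec \<theta>0) \<bullet> u = 1)"
  proof -
    have "(?r \<theta>0 *\<^sub>R unit_vec \<theta>0) \<bullet> u = 1 \<longleftrightarrow> unit_vec \<theta>0 \<bullet> u = ?s \<theta>0" for u
      using s[of \<theta>0] by (auto simp: polar_radius_eq[OF assms] field_simps)
    then show ?thesis by simp
  qed
  finally show ?thesis .
qed

subsection \<open>Extremals with constant covector\<close>

lemma AE_lebesgue_iff_negligible:
  "(AE t in lebesgue. P t) \<longleftrightarrow> (\<exists>N. negligible N \<and> (\<forall>t. t \<notin> N \<longrightarrow> P t))"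
  by (auto simp: eventually_ae_filter negligible_iff_null_sets)

lemma locally_absolutely_continuous_affine:
  fixes f :: "real \<Rightarrow> 'a::euclidean_space"
  assumes ac: "locally_absolutely_continuous_on UNIV f" and N: "negligible N"
    and deriv: "\<And>t. t \<notin> N \<Longrightarrow> (f has_vector_derivative c) (at t)"
  shows "f t = f s + (t - s) *\<^sub>R c"
proof -
  have *: "f b - f a = (b - a) *\<^sub>R c" if "a \<le> b" for a b
    using ac that N deriv
    by (intro absolutely_continuous_increment_eq[where N = N])
      (auto simp: locally_absolutely_continuous_on_def intro: has_vector_derivative_at_within)
  show ?thesis
  proof (cases "s \<le> t")
    case True
    with *[of s t] show ?thesis by (simp add: algebra_simps)
  next
    case False
    with *[of t s] show ?thesis by (simp add: algebra_simps)
  qed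
qed

lemma locally_absolutely_continuous_on_inner:
  fixes f :: "real \<Rightarrow> 'a::real_inner"
  assumes "locally_absolutely_continuous_on J f"
  shows "locally_absolutely_continuous_on J (\<lambda>t. c \<bullet> f t)"
  using assms absolutely_continuous_fun_on_inner
  unfolding locally_absolutely_continuous_on_def by blast

lemma has_vector_derivative_inner_left:
  assumes "(f has_vector_derivative D) F"
  shows "((\<lambda>t. c \<bullet> f t) has_vector_derivative c \<bullet> D) F"
  using assms bounded_linear.has_vector_derivative[OF bounded_linear_inner_right] by blast

text \<open>Plays two roles: the covector with vanishing components along z, v, w, and the Lie
  algebra element u_1 X + u_2 Y, whose multiples form a one-parameter subgroup.\<close>

definition horizontal :: "real^2 \<Rightarrow> real^5" where
  "horizontal h = vector [h $ 1, h $ 2, 0, 0, 0]"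

lemma horizontal_components [simp]:
  "horizontal h $ 1 = h $ 1" "horizontal h $ 2 = h $ 2"
  "horizontal h $ 3 = 0" "horizontal h $ 4 = 0" "horizontal h $ 5 = 0"
  by (simp_all add: horizontal_def)

lemma horizontal_inner_fields:
  "horizontal h \<bullet> (u $ 1 *\<^sub>R field_X p + u $ 2 *\<^sub>R field_Y p) = h \<bullet> u"
  by (simp add: horizontal_def field_X_def field_Y_def inner_vec_def sum_5 sum_2)

lemma momenta_horizontal: "momenta p (horizontal h) = h"
  by (simp add: vec_eq_iff forall_2 momenta_components horizontal_def)

lemma hamiltonian_eq_inner: "hamiltonian p \<psi> u = momenta p \<psi> \<bullet> u"
  by (simp add: hamiltonian_def inner_real2)

text \<open>The Hamiltonian does not contain v and w; it contains z only with a factor \<psi>_4 or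
  \<psi>_5, and x, y only with a factor \<psi>_3, \<psi>_4 or \<psi>_5. This makes the adjoint
  system triangular.\<close>

lemma hamiltonian_gradient:
  assumes "GDERIV (\<lambda>p. hamiltonian p \<psi> u) p :> G"
  shows "G $ 4 = 0" "G $ 5 = 0"
    and "\<psi> $ 4 = 0 \<Longrightarrow> \<psi> $ 5 = 0 \<Longrightarrow> G $ 3 = 0"
    and "\<psi> $ 3 = 0 \<Longrightarrow> \<psi> $ 4 = 0 \<Longrightarrow> \<psi> $ 5 = 0 \<Longrightarrow> G = 0"
proof -
  let ?L = "\<lambda>d. (- (1/2) * \<psi>$3 * d$2 - (1/12) * \<psi>$4 * (d$1 * p$2 + p$1 * d$2)
        - (1/6) * \<psi>$5 * p$2 * d$2 - (1/2) * \<psi>$4 * d$3) * u$1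
      + ((1/2) * \<psi>$3 * d$1 + (1/6) * \<psi>$4 * p$1 * d$1
        + (1/12) * \<psi>$5 * (d$1 * p$2 + p$1 * d$2) - (1/2) * \<psi>$5 * d$3) * u$2"
  have "((\<lambda>p. hamiltonian p \<psi> u) has_derivative ?L) (at p)"
    unfolding hamiltonian_def momenta_components
    by (auto intro!: derivative_eq_intros bounded_linear.has_derivative[OF bounded_linear_vec_nth]
        simp: fun_eq_iff field_simps power2_eq_square)
  then have "(\<lambda>d. d \<bullet> G) = ?L"
    using assms has_derivative_unique unfolding gderiv_def by blast
  then have G: "G $ i = ?L (axis i 1)" for i
    by (metis inner_axis' inner_real_def mult_1)
  show "G $ 4 = 0" "G $ 5 = 0" unfolding G by (simp_all add: axis_def)
  show "G $ 3 = 0" if "\<psi> $ 4 = 0" "\<psi> $ 5 = 0" unfolding G using that by (simp add: axis_def)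
  show "G = 0" if "\<psi> $ 3 = 0" "\<psi> $ 4 = 0" "\<psi> $ 5 = 0"
    unfolding vec_eq_iff G using that by simp
qed

text \<open>Only one component of the derivative has to be known, so triangular systems can be
  integrated coordinate by coordinate. Used for the covector with \<open>c = 0\<close> and for
  trajectories under constant control.\<close>

lemma real5_component_constant:
  fixes f :: "real \<Rightarrow> real^5"
  assumes ac: "locally_absolutely_continuous_on UNIV f" and N: "negligible N"
    and deriv: "\<And>t. t \<notin> N \<Longrightarrow> \<exists>D. (f has_vector_derivative D) (at t) \<and> D $ i = c"
  shows "f t $ i = f 0 $ i + t * c"
proof -
  have "axis i 1 \<bullet> f t = axis i 1 \<bullet> f 0 + (t - 0) *\<^sub>R c"
  proof (rule locally_absolutely_continuous_affine[OF locally_absolutely_continuous_on_inner[OF ac] N])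
    fix t assume "t \<notin> N"
    then obtain D where "(f has_vector_derivative D) (at t)" "D $ i = c" using deriv by blast
    then show "((\<lambda>t. axis i 1 \<bullet> f t) has_vector_derivative c) (at t)"
      using has_vector_derivative_inner_left[of f D "at t" "axis i 1"] by (simp add: inner_axis')
  qed
  then show ?thesis by (simp add: inner_axis')
qed

lemma flat_extremal_covector_constant:
  assumes "extremal F g u \<psi>" "\<psi> 0 $ 3 = 0" "\<psi> 0 $ 4 = 0" "\<psi> 0 $ 5 = 0"
  shows "\<psi> t = \<psi> 0"
proof -
  have ac: "locally_absolutely_continuous_on UNIV \<psi>"
    using assms(1) by (simp add: extremal_def)
  have "AE t in lebesgue. \<exists>G. GDERIV (\<lambda>p. hamiltonian p (\<psi> t) (u t)) (g t) :> G \<and>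
        (\<psi> has_vector_derivative - G) (at t)"
    using assms(1) by (simp add: extremal_def)
  then obtain N where N: "negligible N" "\<And>t. t \<notin> N \<Longrightarrow>
      \<exists>G. GDERIV (\<lambda>p. hamiltonian p (\<psi> t) (u t)) (g t) :> G \<and> (\<psi> has_vector_derivative - G) (at t)"
    unfolding AE_lebesgue_iff_negligible by blast
  have "\<exists>D. (\<psi> has_vector_derivative D) (at t) \<and> D $ 4 = 0" if "t \<notin> N" for t
    using N(2)[OF that] hamiltonian_gradient(1) by fastforce
  from real5_component_constant[OF ac N(1) this] have 4: "\<psi> t $ 4 = 0" for t
    using assms by simp
  have "\<exists>D. (\<psi> has_vector_derivative D) (at t) \<and> D $ 5 = 0" if "t \<notin> N" for t
    using N(2)[OF that] hamiltonian_gradient(2) by fastforce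
  from real5_component_constant[OF ac N(1) this] have 5: "\<psi> t $ 5 = 0" for t
    using assms by simp
  have "\<exists>D. (\<psi> has_vector_derivative D) (at t) \<and> D $ 3 = 0" if "t \<notin> N" for t
    using N(2)[OF that] hamiltonian_gradient(3)[OF _ 4 5] by fastforce
  from real5_component_constant[OF ac N(1) this] have 3: "\<psi> t $ 3 = 0" for t
    using assms by simp
  have "(\<psi> has_vector_derivative 0) (at t)" if "t \<notin> N" for t
    using N(2)[OF that] hamiltonian_gradient(4)[OF _ 3 4 5] by fastforce
  from locally_absolutely_continuous_affine[OF ac N(1) this, of t 0] show ?thesis by simp
qed

lemma flat_extremalE:
  assumes ex: "extremal F g u \<psi>" and flat: "\<psi> 0 $ 3 = 0" "\<psi> 0 $ 4 = 0" "\<psi> 0 $ 5 = 0"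
  obtains h N where "\<And>t. momenta (g t) (\<psi> t) = h" "support_fun (control_set F) h = 1"
    "negligible N" "\<And>t. t \<notin> N \<Longrightarrow> h \<bullet> u t = 1"
    "\<And>t. t \<notin> N \<Longrightarrow>
      (g has_vector_derivative (u t $ 1 *\<^sub>R field_X (g t) + u t $ 2 *\<^sub>R field_Y (g t))) (at t)"
proof -
  define h where "h = (vector [\<psi> 0 $ 1, \<psi> 0 $ 2] :: real^2)"
  have "\<psi> t = horizontal h" for t
    using flat_extremal_covector_constant[OF assms, of t] flat
    by (simp add: vec_eq_iff forall_5 horizontal_def h_def)
  then have h: "momenta (g t) (\<psi> t) = h" for t by (simp add: momenta_horizontal)
  have "AE t in lebesgue. h \<bullet> u t = support_fun (control_set F) h \<and> support_fun (control_set F) h = 1"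
    using ex by (simp add: extremal_def hamiltonian_eq_inner h)
  moreover have "AE t in lebesgue.
      (g has_vector_derivative (u t $ 1 *\<^sub>R field_X (g t) + u t $ 2 *\<^sub>R field_Y (g t))) (at t)"
    using ex by (simp add: extremal_def trajectory_def)
  ultimately have "AE t in lebesgue. (h \<bullet> u t = 1 \<and> support_fun (control_set F) h = 1) \<and>
      (g has_vector_derivative (u t $ 1 *\<^sub>R field_X (g t) + u t $ 2 *\<^sub>R field_Y (g t))) (at t)"
    by (auto elim: AE_mp)
  then obtain N where N: "negligible N" "\<And>t. t \<notin> N \<Longrightarrow>
      (h \<bullet> u t = 1 \<and> support_fun (control_set F) h = 1) \<and>
      (g has_vector_derivative (u t $ 1 *\<^sub>R field_X (g t) + u t $ 2 *\<^sub>R field_Y (g t))) (at t)"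
    unfolding AE_lebesgue_iff_negligible by blast
  \<comment> \<open>The normalization of \<open>h\<close> does not involve the time, so a single
    time outside \<open>N\<close> establishes it.\<close>
  have "N \<noteq> UNIV" using N(1) non_negligible_UNIV by blast
  then have "support_fun (control_set F) h = 1" using N(2) by blast
  with that[of h N] h N show thesis by blast
qed

text \<open>
  The lower bound on the distance: the linear functional \<open>horizontal h\<close> grows along any
  trajectory at rate at most \<open>support_fun U h\<close>, and along a flat extremal at exactly this rate.
\<close>

lemma trajectory_horizontal_increment_le:
  assumes U: "compact U" and T: "0 \<le> T" and tr: "trajectory U {0..T} g u"
  shows "horizontal h \<bullet> g T - horizontal h \<bullet> g 0 \<le> support_fun U h * T"
proof -
  have ac: "absolutely_continuous_fun_on {0..T} g"
    using tr by (auto simp: trajectory_def locally_absolutely_continuous_on_def)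
  have "AE t in lebesgue. t \<in> {0..T} \<longrightarrow>
      (g has_vector_derivative (u t $ 1 *\<^sub>R field_X (g t) + u t $ 2 *\<^sub>R field_Y (g t))) (at t within {0..T})"
    using tr by (simp add: trajectory_def)
  then obtain N where N: "negligible N" "\<And>t. t \<notin> N \<Longrightarrow> t \<in> {0..T} \<longrightarrow>
      (g has_vector_derivative (u t $ 1 *\<^sub>R field_X (g t) + u t $ 2 *\<^sub>R field_Y (g t))) (at t within {0..T})"
    unfolding AE_lebesgue_iff_negligible by blast
  have "horizontal h \<bullet> g T - horizontal h \<bullet> g 0 \<le> support_fun U h * (T - 0)"
  proof (rule absolutely_continuous_increment_le[OF T absolutely_continuous_fun_on_inner[OF ac] N(1)])
    fix t assume t: "t \<in> {0..T} - N"
    then have "((\<lambda>t. horizontal h \<bullet> g t) has_vector_derivative h \<bullet> u t) (at t within {0..T})"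
      using has_vector_derivative_inner_left[of g _ "at t within {0..T}" "horizontal h"] N(2)
      by (metis DiffE horizontal_inner_fields)
    moreover have "h \<bullet> u t \<le> support_fun U h"
      using tr t by (intro inner_le_support_fun[OF U]) (auto simp: trajectory_def)
    ultimately show "\<exists>D\<le>support_fun U h.
        ((\<lambda>t. horizontal h \<bullet> g t) has_vector_derivative D) (at t within {0..T})" by blast
  qed
  then show ?thesis by simp
qed

section \<open>Segments of extremals as competitors for the distance\<close>

lemma measurable_lebesgue_shift: "(\<lambda>t. c + t) \<in> lebesgue \<rightarrow>\<^sub>M (lebesgue :: real measure)"
proof (rule measurableI)
  fix S :: "real set" assume "S \<in> sets lebesgue"
  \<comment> \<open>Preimages under a translation are translates, so Lebesgue sets, not only Borel
    sets, pull back to Lebesgue sets.\<close>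
  moreover have "(\<lambda>t. c + t) -` S \<inter> space lebesgue = (\<lambda>t. - c + t) ` S"
    by (auto simp: image_iff) (metis add.left_inverse add.assoc add_0 uminus_add_conv_diff)
  ultimately show "(\<lambda>t. c + t) -` S \<inter> space lebesgue \<in> sets lebesgue"
    using lebesgue_sets_translation by metis
qed simp

lemma trajectory_shift:
  assumes "trajectory U UNIV g u"
  shows "trajectory U {0..T} (\<lambda>t. g (c + t)) (\<lambda>t. u (c + t))"
  unfolding trajectory_def
proof (intro conjI)
  show "locally_absolutely_continuous_on {0..T} (\<lambda>t. g (c + t))"
    unfolding locally_absolutely_continuous_on_def
  proof (intro allI impI absolutely_continuous_fun_on_shift)
    fix a b
    have "(+) c ` {a..b} = {c + a..c + b}" by (simp add: add.commute)
    then show "absolutely_continuous_fun_on ((+) c ` {a..b}) g"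
      using assms by (simp add: trajectory_def locally_absolutely_continuous_on_def)
  qed
  have "u \<in> borel_measurable lebesgue"
    using assms lebesgue_on_UNIV_eq by (metis trajectory_def)
  from measurable_compose[OF measurable_lebesgue_shift this]
  show "(\<lambda>t. u (c + t)) \<in> borel_measurable (lebesgue_on {0..T})"
    by (rule measurable_restrict_space1)
  show "\<forall>t\<in>{0..T}. u (c + t) \<in> U" using assms by (simp add: trajectory_def)
  have "AE t in lebesgue.
      (g has_vector_derivative (u t $ 1 *\<^sub>R field_X (g t) + u t $ 2 *\<^sub>R field_Y (g t))) (at t)"
    using assms by (simp add: trajectory_def)
  then obtain N where N: "negligible N" "\<And>t. t \<notin> N \<Longrightarrow>
      (g has_vector_derivative (u t $ 1 *\<^sub>R field_X (g t) + u t $ 2 *\<^sub>R field_Y (g t))) (at t)"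
    unfolding AE_lebesgue_iff_negligible by blast
  show "AE t\<in>{0..T} in lebesgue. ((\<lambda>t. g (c + t)) has_vector_derivative
      (u (c + t) $ 1 *\<^sub>R field_X (g (c + t)) + u (c + t) $ 2 *\<^sub>R field_Y (g (c + t)))) (at t within {0..T})"
    unfolding AE_lebesgue_iff_negligible
  proof (intro exI conjI allI impI)
    show "negligible ((+) (- c) ` N)" using N(1) by (rule negligible_translation)
    fix t assume "t \<notin> (+) (- c) ` N"
    then have "c + t \<notin> N" by (auto simp: image_iff)
    moreover have "((\<lambda>t. c + t) has_vector_derivative 1) (at t)"
      by (auto intro!: derivative_eq_intros)
    ultimately have "((\<lambda>t. g (c + t)) has_vector_derivative
      (u (c + t) $ 1 *\<^sub>R field_X (g (c + t)) + u (c + t) $ 2 *\<^sub>R field_Y (g (c + t)))) (at t)"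
      using vector_diff_chain_at[of "\<lambda>t. c + t" 1 t g] N(2) by (auto simp: o_def)
    then show "((\<lambda>t. g (c + t)) has_vector_derivative
      (u (c + t) $ 1 *\<^sub>R field_X (g (c + t)) + u (c + t) $ 2 *\<^sub>R field_Y (g (c + t)))) (at t within {0..T})"
      by (blast intro: has_vector_derivative_at_within)
  qed
qed

text \<open>The infimum is shown to be a minimum: the shifted segment makes \<open>t2 - t1\<close>
  an admissible time, which also settles nonemptiness, and the calibration bounds every admissible
  time from below.\<close>

lemma flat_extremal_metric_straight_line:
  assumes qn: "quasinorm F" and ex: "extremal F g u \<psi>"
    and flat: "\<psi> 0 $ 3 = 0" "\<psi> 0 $ 4 = 0" "\<psi> 0 $ 5 = 0"
  shows "metric_straight_line F g"
  unfolding metric_straight_line_def cartan_dist_def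
proof (intro allI impI cInf_eq_minimum)
  fix t1 t2 :: real assume le: "t1 \<le> t2"
  obtain h N where h: "support_fun (control_set F) h = 1" "negligible N"
    "\<And>t. t \<notin> N \<Longrightarrow> h \<bullet> u t = 1"
    "\<And>t. t \<notin> N \<Longrightarrow>
      (g has_vector_derivative (u t $ 1 *\<^sub>R field_X (g t) + u t $ 2 *\<^sub>R field_Y (g t))) (at t)"
    using flat_extremalE[OF ex flat] by metis
  have tr: "trajectory (control_set F) UNIV g u" using ex by (simp add: extremal_def)
  have "horizontal h \<bullet> g t2 = horizontal h \<bullet> g t1 + (t2 - t1) *\<^sub>R 1"
  proof (rule locally_absolutely_continuous_affine[OF _ h(2)])
    show "locally_absolutely_continuous_on UNIV (\<lambda>t. horizontal h \<bullet> g t)"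
      using tr by (intro locally_absolutely_continuous_on_inner) (simp add: trajectory_def)
    fix t assume "t \<notin> N"
    then show "((\<lambda>t. horizontal h \<bullet> g t) has_vector_derivative 1) (at t)"
      using has_vector_derivative_inner_left[OF h(4), of t "horizontal h"] h(3)
      by (simp add: horizontal_inner_fields)
  qed
  then have incr: "horizontal h \<bullet> g t2 - horizontal h \<bullet> g t1 = t2 - t1" by simp
  show "t2 - t1 \<in> travel_times (control_set F) (g t1) (g t2)"
    unfolding travel_times_def using le trajectory_shift[OF tr, of "t2 - t1" t1]
    by (auto intro!: exI[of _ "\<lambda>t. g (t1 + t)"] exI[of _ "\<lambda>t. u (t1 + t)"])
  fix T assume "T \<in> travel_times (control_set F) (g t1) (g t2)"
  then obtain g' u' where "0 \<le> T" "trajectory (control_set F) {0..T} g' u'" "g' 0 = g t1" "g' T = g t2"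
    by (auto simp: travel_times_def)
  then show "t2 - t1 \<le> T"
    using trajectory_horizontal_increment_le[OF compact_control_set[OF qn], of T g' u' h] h(1) incr
    by simp
qed

section \<open>The polar angle along a flat extremal\<close>

lemma polar_angle_iff:
  "polar_angle F g \<psi> \<theta> \<longleftrightarrow> continuous_on UNIV \<theta> \<and>
    (\<forall>t. momenta (g t) (\<psi> t) = polar_radius (control_set F) (\<theta> t) *\<^sub>R unit_vec (\<theta> t))"
  by (simp add: polar_angle_def vec_eq_iff forall_2)

lemma flat_extremal_polar_angle_exists:
  assumes qn: "quasinorm F" and ex: "extremal F g u \<psi>"
    and flat: "\<psi> 0 $ 3 = 0" "\<psi> 0 $ 4 = 0" "\<psi> 0 $ 5 = 0"
  shows "\<exists>\<theta>. polar_angle F g \<psi> \<theta>"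
proof -
  obtain h where h: "\<And>t. momenta (g t) (\<psi> t) = h" "support_fun (control_set F) h = 1"
    using flat_extremalE[OF ex flat] by metis
  obtain \<theta> where \<theta>: "h = norm h *\<^sub>R unit_vec \<theta>" by (rule real2_polarE)
  then have "polar_radius (control_set F) \<theta> = norm h"
    using h(2) by (intro polar_radius_unique[OF qn]) auto
  with h(1) \<theta> have "polar_angle F g \<psi> (\<lambda>_. \<theta>)" by (simp add: polar_angle_iff)
  then show ?thesis by blast
qed

text \<open>Any two values of the angle differ by a multiple of 2 pi, so its range is discrete, and
  connectedness of the line leaves a single value.\<close>

lemma continuous_angle_constant:
  assumes "continuous_on UNIV \<theta>" "\<And>s t. unit_vec (\<theta> s) = unit_vec (\<theta> t)"
  shows "\<theta> t = \<theta> (0::real)"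
proof -
  have "\<theta> constant_on UNIV"
  proof (rule continuous_discrete_range_constant[OF connected_UNIV assms(1)])
    fix s
    have "2 * pi \<le> norm (\<theta> t - \<theta> s)" if "\<theta> t \<noteq> \<theta> s" for t
    proof -
      have "sin (\<theta> t) = sin (\<theta> s) \<and> cos (\<theta> t) = cos (\<theta> s)"
        using assms(2)[of t s] by (simp add: vec_eq_iff forall_2)
      then obtain n :: int where n: "\<theta> t = \<theta> s + 2 * pi * n"
        unfolding sin_cos_eq_iff by blast
      with that have "n \<noteq> 0" by auto
      then have "1 \<le> \<bar>real_of_int n\<bar>" by linarith
      then have "2 * pi * 1 \<le> 2 * pi * \<bar>real_of_int n\<bar>" by (intro mult_left_mono) auto
      with n show ?thesis by (simp add: abs_mult)
    qed
    then show "\<exists>e>0. \<forall>t. t \<in> UNIV \<and> \<theta> t \<noteq> \<theta> s \<longrightarrow> e \<le> norm (\<theta> t - \<theta> s)"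
      by (intro exI[of _ "2 * pi"]) auto
  qed
  then show ?thesis by (auto simp: constant_on_def)
qed

lemma flat_extremal_polar_angle_constant:
  assumes qn: "quasinorm F" and ex: "extremal F g u \<psi>"
    and flat: "\<psi> 0 $ 3 = 0" "\<psi> 0 $ 4 = 0" "\<psi> 0 $ 5 = 0"
    and angle: "polar_angle F g \<psi> \<theta>"
  shows "\<theta> t = \<theta> 0"
proof (rule continuous_angle_constant)
  show "continuous_on UNIV \<theta>" using angle by (simp add: polar_angle_def)
  obtain h where h: "\<And>t. momenta (g t) (\<psi> t) = h"
    using flat_extremalE[OF ex flat] by metis
  have "unit_vec (\<theta> t) = (1 / norm h) *\<^sub>R h" for t
  proof -
    have "h = polar_radius (control_set F) (\<theta> t) *\<^sub>R unit_vec (\<theta> t)"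
      using angle h by (simp add: polar_angle_iff)
    then show ?thesis using polar_radius_pos[OF qn, of "\<theta> t"] by simp
  qed
  then show "unit_vec (\<theta> s) = unit_vec (\<theta> t)" for s t by simp
qed

section \<open>Straight and broken horizontal lines\<close>

lemma horizontal_line_velocity:
  "u $ 1 *\<^sub>R field_X (t *\<^sub>R horizontal u) + u $ 2 *\<^sub>R field_Y (t *\<^sub>R horizontal u) = horizontal u"
  \<comment> \<open>On this line z = 0 and x u_2 = y u_1, so the last three components
    cancel.\<close>
  by (simp add: vec_eq_iff forall_5 field_X_def field_Y_def horizontal_def algebra_simps power2_eq_square)

lemma horizontal_line_subgroup: "one_parameter_subgroup (\<lambda>t. t *\<^sub>R horizontal u)"
  unfolding one_parameter_subgroup_def
proof (intro conjI allI)
  show "continuous_on UNIV (\<lambda>t. t *\<^sub>R horizontal u)" by (intro continuous_intros)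
  show "(s + t) *\<^sub>R horizontal u = cartan_mult (s *\<^sub>R horizontal u) (t *\<^sub>R horizontal u)" for s t
    by (simp add: vec_eq_iff forall_5 cartan_mult_def cartan_bracket_def horizontal_def algebra_simps)
qed

text \<open>The control system is triangular: the rates of x, y depend on the control alone, that of
  z also on x, y, and those of v, w on x, y, z. For a constant control each rate in turn becomes a
  known constant.\<close>

lemma trajectory_constant_control:
  assumes tr: "trajectory U UNIV g u" and g0: "g 0 = 0"
    and N: "negligible N" and u0: "\<And>t. t \<notin> N \<Longrightarrow> u t = u0"
  shows "g t = t *\<^sub>R horizontal u0"
proof -
  have ac: "locally_absolutely_continuous_on UNIV g" using tr by (simp add: trajectory_def)
  have "AE t in lebesgue.
      (g has_vector_derivative (u t $ 1 *\<^sub>R field_X (g t) + u t $ 2 *\<^sub>R field_Y (g t))) (at t)"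
    using tr by (simp add: trajectory_def)
  then obtain N' where N': "negligible N'" "\<And>t. t \<notin> N' \<Longrightarrow>
      (g has_vector_derivative (u t $ 1 *\<^sub>R field_X (g t) + u t $ 2 *\<^sub>R field_Y (g t))) (at t)"
    unfolding AE_lebesgue_iff_negligible by blast
  let ?M = "N \<union> N'"
  have M: "negligible ?M" using N N'(1) by simp
  let ?D = "\<lambda>t. u0 $ 1 *\<^sub>R field_X (g t) + u0 $ 2 *\<^sub>R field_Y (g t)"
  have D: "(g has_vector_derivative ?D t) (at t)" if "t \<notin> ?M" for t
    using N'(2)[of t] u0[of t] that by auto
  have comp: "g t $ i = t * c" if "\<And>t. t \<notin> ?M \<Longrightarrow> ?D t $ i = c" for i c t
  proof -
    have "\<exists>D. (g has_vector_derivative D) (at t) \<and> D $ i = c" if "t \<notin> ?M" for t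
      using D[OF that] \<open>\<And>t. t \<notin> ?M \<Longrightarrow> ?D t $ i = c\<close>[OF that] by blast
    from real5_component_constant[OF ac M this] show ?thesis using g0 by simp
  qed
  have x: "g t $ 1 = t * u0 $ 1" for t by (rule comp) (simp add: field_X_def field_Y_def)
  have y: "g t $ 2 = t * u0 $ 2" for t by (rule comp) (simp add: field_X_def field_Y_def)
  have z: "g t $ 3 = t * 0" for t by (rule comp) (simp add: field_X_def field_Y_def x y)
  have v: "g t $ 4 = t * 0" for t
    by (rule comp) (simp add: field_X_def field_Y_def x y z power2_eq_square)
  have w: "g t $ 5 = t * 0" for t
    by (rule comp) (simp add: field_X_def field_Y_def x y z power2_eq_square)
  show ?thesis by (simp add: vec_eq_iff forall_5 x y z v w horizontal_def)
qed

lemma flat_extremal_one_parameter_subgroup: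
  assumes ex: "extremal F g u \<psi>" and g0: "g 0 = 0"
    and flat: "\<psi> 0 $ 3 = 0" "\<psi> 0 $ 4 = 0" "\<psi> 0 $ 5 = 0"
    and uniq: "\<exists>!v. v \<in> control_set F \<and> momenta (g 0) (\<psi> 0) \<bullet> v = 1"
  shows "one_parameter_subgroup g"
proof -
  obtain h N where h: "\<And>t. momenta (g t) (\<psi> t) = h" "negligible N" "\<And>t. t \<notin> N \<Longrightarrow> h \<bullet> u t = 1"
    using flat_extremalE[OF ex flat] by metis
  obtain u0 where u0: "\<And>v. v \<in> control_set F \<Longrightarrow> h \<bullet> v = 1 \<Longrightarrow> v = u0"
    using uniq h(1) by auto
  have tr: "trajectory (control_set F) UNIV g u" using ex by (simp add: extremal_def)
  then have "u t = u0" if "t \<notin> N" for t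
    using u0 h(3) that by (simp add: trajectory_def)
  from trajectory_constant_control[OF tr g0 h(2) this] have "g = (\<lambda>t. t *\<^sub>R horizontal u0)" by auto
  then show ?thesis by (simp add: horizontal_line_subgroup)
qed

lemma lipschitz_locally_absolutely_continuous:
  fixes f :: "real \<Rightarrow> 'a::real_normed_vector"
  assumes "\<And>s t. norm (f s - f t) \<le> L * \<bar>s - t\<bar>"
  shows "locally_absolutely_continuous_on J f"
  unfolding locally_absolutely_continuous_on_def
  by (auto intro!: absolutely_continuous_fun_on_dominated[OF absolutely_continuous_fun_on_id, where L = L]
      simp: assms)

lemma broken_line_lipschitz:
  fixes a b :: "'a::real_normed_vector"
  defines "f \<equiv> \<lambda>t. if t \<le> 0 then t *\<^sub>R a else t *\<^sub>R b"
  shows "norm (f s - f t) \<le> (norm a + norm b) * \<bar>s - t\<bar>"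
proof -
  \<comment> \<open>The parts \<open>min t 0\<close> and \<open>max t 0\<close> are each
    1-Lipschitz, which spares a case distinction on the signs of \<open>s\<close> and
    \<open>t\<close>.\<close>
  have f: "f t = min t 0 *\<^sub>R a + max t 0 *\<^sub>R b" for t by (simp add: f_def min_def max_def)
  have "f s - f t = (min s 0 - min t 0) *\<^sub>R a + (max s 0 - max t 0) *\<^sub>R b"
    by (simp add: f algebra_simps)
  also have "norm \<dots> \<le> \<bar>min s 0 - min t 0\<bar> * norm a + \<bar>max s 0 - max t 0\<bar> * norm b"
    by (metis norm_scaleR norm_triangle_ineq)
  also have "\<dots> \<le> \<bar>s - t\<bar> * norm a + \<bar>s - t\<bar> * norm b"
    by (intro add_mono mult_right_mono) auto
  finally show ?thesis by (simp add: algebra_simps)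
qed

text \<open>
  If the maximum of \<open>h \<bullet> u\<close> is attained at two controls, the two half-lines from the unit in
  these directions form an extremal that is not a one-parameter subgroup.
\<close>

lemma broken_line_extremal:
  assumes h: "support_fun (control_set F) h = 1" "h \<noteq> 0"
    and a: "a \<in> control_set F" "h \<bullet> a = 1" and b: "b \<in> control_set F" "h \<bullet> b = 1"
  shows "extremal F (\<lambda>t. if t \<le> 0 then t *\<^sub>R horizontal a else t *\<^sub>R horizontal b)
    (\<lambda>t. if t \<le> 0 then a else b) (\<lambda>t. horizontal h)" (is "extremal F ?g ?u _")
  unfolding extremal_def trajectory_def
proof (intro conjI allI ballI)
  show "locally_absolutely_continuous_on UNIV ?g"
    using broken_line_lipschitz by (rule lipschitz_locally_absolutely_continuous)
  have "?u \<in> borel_measurable borel" by measurable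
  then have "?u \<in> borel_measurable lborel" by simp
  from measurable_completion[OF this] show "?u \<in> borel_measurable (lebesgue_on UNIV)" by simp
  show "?u t \<in> control_set F" for t using a(1) b(1) by simp
  show "AE t\<in>UNIV in lebesgue. (?g has_vector_derivative
      (?u t $ 1 *\<^sub>R field_X (?g t) + ?u t $ 2 *\<^sub>R field_Y (?g t))) (at t)"
    unfolding AE_lebesgue_iff_negligible
  proof (intro exI conjI allI impI)
    \<comment> \<open>The corner at time 0 is the only possible point of
      nondifferentiability.\<close>
    show "negligible {0::real}" by simp
    fix t :: real assume "t \<notin> {0}"
    then consider "t < 0" | "0 < t" by fastforce
    then have "(?g has_vector_derivative
      (?u t $ 1 *\<^sub>R field_X (?g t) + ?u t $ 2 *\<^sub>R field_Y (?g t))) (at t)"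
    proof cases
      case 1
      have "((\<lambda>t. t *\<^sub>R horizontal a) has_vector_derivative horizontal a) (at t)"
        by (auto intro!: derivative_eq_intros)
      then have "(?g has_vector_derivative horizontal a) (at t)"
        by (rule has_vector_derivative_transform_within_open[of _ _ _ "{..<0}"]) (use 1 in auto)
      with 1 show ?thesis by (simp add: horizontal_line_velocity)
    next
      case 2
      have "((\<lambda>t. t *\<^sub>R horizontal b) has_vector_derivative horizontal b) (at t)"
        by (auto intro!: derivative_eq_intros)
      then have "(?g has_vector_derivative horizontal b) (at t)"
        by (rule has_vector_derivative_transform_within_open[of _ _ _ "{0<..}"]) (use 2 in auto)
      with 2 show ?thesis by (simp add: horizontal_line_velocity)
    qed
    then show "(?g has_vector_derivative
      (?u t $ 1 *\<^sub>R field_X (?g t) + ?u t $ 2 *\<^sub>R field_Y (?g t))) (at t)" .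
  qed
  show "locally_absolutely_continuous_on UNIV (\<lambda>t. horizontal h)"
    by (rule lipschitz_locally_absolutely_continuous[where L = 0]) simp
  show "horizontal h \<noteq> 0" using h(2) by (simp add: horizontal_def vec_eq_iff forall_5 forall_2)
  show "AE t in lebesgue. \<exists>G. GDERIV (\<lambda>p. hamiltonian p (horizontal h) (?u t)) (?g t) :> G \<and>
      ((\<lambda>t. horizontal h) has_vector_derivative - G) (at t)"
    \<comment> \<open>For this covector the Hamiltonian is \<open>h \<bullet> u\<close> at every
      point, so its gradient is 0 and a constant covector solves the adjoint equation.\<close>
    by (intro AE_I2 exI[of _ 0]) (simp add: hamiltonian_eq_inner momenta_horizontal GDERIV_const)
  show "AE t in lebesgue. hamiltonian (?g t) (horizontal h) (?u t)
        = support_fun (control_set F) (momenta (?g t) (horizontal h)) \<and>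
      support_fun (control_set F) (momenta (?g t) (horizontal h)) = 1"
    by (intro AE_I2) (simp add: hamiltonian_eq_inner momenta_horizontal h a b)
qed

text \<open>The values at times 1 and -1 must be inverse to each other, and the first two
  coordinates add under the group law.\<close>

lemma broken_line_subgroup_imp_straight:
  assumes "one_parameter_subgroup (\<lambda>t. if t \<le> 0 then t *\<^sub>R horizontal a else t *\<^sub>R horizontal b)"
  shows "a = b"
proof -
  have "(0::real^5) = cartan_mult (horizontal b) (- horizontal a)"
    using assms[unfolded one_parameter_subgroup_def, THEN conjunct2, rule_format, of 1 "-1"] by simp
  then show ?thesis
    by (simp add: vec_eq_iff forall_5 forall_2 cartan_mult_def cartan_bracket_def horizontal_def)
qed

lemma flat_extremals_subgroups_iff:
  fixes F :: "real^2 \<Rightarrow> real"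
  assumes qn: "quasinorm F"
  shows "(\<forall>g u \<psi>. extremal F g u \<psi> \<and> g 0 = 0 \<and> \<psi> 0 $ 3 = 0 \<and> \<psi> 0 $ 4 = 0 \<and> \<psi> 0 $ 5 = 0 \<and>
            polar_angle F g \<psi> (\<lambda>t. \<theta>\<^sub>0) \<longrightarrow> one_parameter_subgroup g)
        \<longleftrightarrow> polar_radius (control_set F) differentiable (at \<theta>\<^sub>0)"
    (is "?all \<longleftrightarrow> _")
proof -
  define h where "h = polar_radius (control_set F) \<theta>\<^sub>0 *\<^sub>R unit_vec \<theta>\<^sub>0"
  have h: "support_fun (control_set F) h = 1" "h \<noteq> 0"
    using support_fun_polar_radius[OF qn, of \<theta>\<^sub>0] polar_radius_pos[OF qn, of \<theta>\<^sub>0]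
    by (auto simp: h_def)
  have "?all \<longleftrightarrow> (\<exists>!v. v \<in> control_set F \<and> h \<bullet> v = 1)"
  proof
    assume all: ?all
    have "a = b" if "a \<in> control_set F" "h \<bullet> a = 1" "b \<in> control_set F" "h \<bullet> b = 1" for a b
    proof (rule broken_line_subgroup_imp_straight)
      let ?g = "\<lambda>t. if t \<le> 0 then t *\<^sub>R horizontal a else t *\<^sub>R horizontal b"
      have "polar_angle F ?g (\<lambda>t. horizontal h) (\<lambda>t. \<theta>\<^sub>0)"
        by (simp add: polar_angle_iff momenta_horizontal h_def)
      with broken_line_extremal[OF h that] show "one_parameter_subgroup ?g"
        using all[rule_format, of ?g "\<lambda>t. if t \<le> 0 then a else b" "\<lambda>t. horizontal h"] by simp
    qed
    \<comment> \<open>Existence of a maximizer comes from compactness; the broken lines yield only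
      uniqueness.\<close>
    moreover obtain v where "v \<in> control_set F" "h \<bullet> v = 1"
      using support_fun_attained[OF compact_control_set[OF qn]] zero_in_control_set[OF qn] h(1)
      by (metis empty_iff)
    ultimately show "\<exists>!v. v \<in> control_set F \<and> h \<bullet> v = 1" by blast
  next
    assume "\<exists>!v. v \<in> control_set F \<and> h \<bullet> v = 1"
    then show ?all
      using flat_extremal_one_parameter_subgroup unfolding polar_angle_iff h_def by metis
  qed
  then show ?thesis unfolding polar_radius_differentiable_iff[OF qn] h_def .
qed

theorem proposition3:
  fixes F :: "real^2 \<Rightarrow> real"
  assumes "quasinorm F"
  shows
    "(\<forall>g u \<psi>. extremal F g u \<psi> \<and> g 0 = 0 \<and> \<psi> 0 $ 3 = 0 \<and> \<psi> 0 $ 4 = 0 \<and> \<psi> 0 $ 5 = 0 \<longrightarrow>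
        (\<exists>\<theta>. polar_angle F g \<psi> \<theta>) \<and>
        (\<forall>\<theta>. polar_angle F g \<psi> \<theta> \<longrightarrow> (\<exists>\<theta>\<^sub>0. \<forall>t. \<theta> t = \<theta>\<^sub>0))) \<and>
     (\<forall>\<theta>\<^sub>0.
        (\<forall>g u \<psi>. extremal F g u \<psi> \<and> g 0 = 0 \<and> \<psi> 0 $ 3 = 0 \<and> \<psi> 0 $ 4 = 0 \<and> \<psi> 0 $ 5 = 0 \<and>
            polar_angle F g \<psi> (\<lambda>t. \<theta>\<^sub>0) \<longrightarrow> one_parameter_subgroup g)
        \<longleftrightarrow> polar_radius (control_set F) differentiable (at \<theta>\<^sub>0)) \<and>
     (\<forall>g u \<psi>. extremal F g u \<psi> \<and> \<psi> 0 $ 3 = 0 \<and> \<psi> 0 $ 4 = 0 \<and> \<psi> 0 $ 5 = 0 \<longrightarrow>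
        metric_straight_line F g)"
  using flat_extremal_polar_angle_exists[OF assms] flat_extremal_polar_angle_constant[OF assms]
    flat_extremals_subgroups_iff[OF assms] flat_extremal_metric_straight_line[OF assms]
  by (intro conjI) (blast+)

end
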